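(* Let $d=d_n\in\mathbb{N}$ with $d=o(\log n)$, let $\sigma=\sigma_n>0$, let $X_1,\dots,X_n$ be i.i.d. $\mathcal N(0,I_d)$ and $Z_1,\dots,Z_n$ be i.i.d. $\mathcal N(0,\sigma^2I_d)$, and let $Y_i=X_{\pi^\star(i)}+Z_i$ for $i\in[n]$, where $\pi^\star$ is uniform on $S_n$. Then as $n\to+\infty$, $$\inf_{\hat\pi}\mathbb{E}\left[d_H(\hat\pi,\pi^\star)\right]=\left(n^{2+o(1)}\sigma^d\right)\wedge n^{1+o(1)}.$$
   Context: The $X$'s, the $Z$'s and $\pi^\star$ are mutually independent. $S_n$ is the group of permutations of $[n]=\{1,\dots,n\}$. An estimator $\hat\pi$ is a (measurable) map taking $(X_1,\dots,X_n,Y_1,\dots,Y_n)$ to a permutation in $S_n$; the infimum is over all estimators. $d_H(\hat\pi,\pi^\star)=\sum_{j=1}^n\mathbf 1[\hat\pi(j)\ne\pi^\star(j)]$. $a\wedge b=\min(a,b)$. *)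

theory Defs
  imports "HOL-Probability.Probability" "HOL-Library.Landau_Symbols"
    "HOL-Combinatorics.Permutations"
begin

definition perms :: "nat \<Rightarrow> (nat \<Rightarrow> nat) set"
  where "perms n = {p. p permutes {1..n}}"

text \<open>The law \<open>N(0, s\<^sup>2 I\<^sub>d)\<close>; vectors in \<open>\<real>\<^sup>d\<close> are extensional functions on \<open>{1..d}\<close>, since the
  dimension varies with \<open>n\<close>. The parameter \<open>s\<close> is the standard deviation, as in
  \<^const>\<open>normal_density\<close>.\<close>

definition gauss_vec :: "nat \<Rightarrow> real \<Rightarrow> (nat \<Rightarrow> real) measure"
  where "gauss_vec d s = (\<Pi>\<^sub>M k\<in>{1..d}. density lborel (\<lambda>x. ennreal (normal_density 0 s x)))"

text \<open>Joint law of \<open>((X\<^sub>i)\<^sub>i, (Z\<^sub>i)\<^sub>i, \<pi>\<^sup>\<star>)\<close>: the product measure encodes mutual independence.\<close>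

definition model ::
    "nat \<Rightarrow> nat \<Rightarrow> real \<Rightarrow> ((nat \<Rightarrow> nat \<Rightarrow> real) \<times> (nat \<Rightarrow> nat \<Rightarrow> real) \<times> (nat \<Rightarrow> nat)) measure"
  where "model n d \<sigma> =
    (\<Pi>\<^sub>M i\<in>{1..n}. gauss_vec d 1) \<Otimes>\<^sub>M (\<Pi>\<^sub>M i\<in>{1..n}. gauss_vec d \<sigma>) \<Otimes>\<^sub>M uniform_count_measure (perms n)"

definition Y_obs ::
    "nat \<Rightarrow> nat \<Rightarrow> (nat \<Rightarrow> nat \<Rightarrow> real) \<Rightarrow> (nat \<Rightarrow> nat \<Rightarrow> real) \<Rightarrow> (nat \<Rightarrow> nat) \<Rightarrow> (nat \<Rightarrow> nat \<Rightarrow> real)"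
  where "Y_obs n d X Z p = (\<lambda>i\<in>{1..n}. \<lambda>k\<in>{1..d}. X (p i) k + Z i k)"

definition points_space :: "nat \<Rightarrow> nat \<Rightarrow> (nat \<Rightarrow> nat \<Rightarrow> real) measure"
  where "points_space n d = (\<Pi>\<^sub>M i\<in>{1..n}. \<Pi>\<^sub>M k\<in>{1..d}. borel)"

definition estimators ::
    "nat \<Rightarrow> nat \<Rightarrow> ((nat \<Rightarrow> nat \<Rightarrow> real) \<times> (nat \<Rightarrow> nat \<Rightarrow> real) \<Rightarrow> (nat \<Rightarrow> nat)) set"
  where "estimators n d = measurable (points_space n d \<Otimes>\<^sub>M points_space n d) (count_space (perms n))"

definition d_H :: "nat \<Rightarrow> (nat \<Rightarrow> nat) \<Rightarrow> (nat \<Rightarrow> nat) \<Rightarrow> real"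
  where "d_H n p q = (\<Sum>j=1..n. of_bool (p j \<noteq> q j))"

definition risk ::
    "nat \<Rightarrow> nat \<Rightarrow> real \<Rightarrow> ((nat \<Rightarrow> nat \<Rightarrow> real) \<times> (nat \<Rightarrow> nat \<Rightarrow> real) \<Rightarrow> (nat \<Rightarrow> nat)) \<Rightarrow> real"
  where "risk n d \<sigma> est = (LINT (X, Z, p)|model n d \<sigma>. d_H n (est (X, Y_obs n d X Z p)) p)"

definition minimal_risk :: "nat \<Rightarrow> nat \<Rightarrow> real \<Rightarrow> real"
  where "minimal_risk n d \<sigma> = (INF est\<in>estimators n d. risk n d \<sigma> est)"

end

theory Submission
  imports Defs
begin

text \<open>Since \<open>d = o(log n)\<close>, factors \<open>C\<^sup>d\<close> are \<open>n\<^sup>o\<^sup>(\<^sup>1\<^sup>)\<close> and may be lost freely.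

  Upper bound: let the estimator be a permutation with the fewest indices \<open>i\<close> for which \<open>X (p i)\<close> is
  not the unique nearest neighbour of \<open>Y i\<close>. Its Hamming distance to the truth is at most twice the
  number of such indices for the truth, and by a Chernoff bound a given wrong \<open>X j\<close> is as near to
  \<open>Y i\<close> as the correct one with probability at most \<open>(2 \<sigma>)\<^sup>d\<close>.

  Lower bound: condition on the \<open>X\<close>. If \<open>X b\<close> lies within \<open>\<sigma>\<close> of \<open>X a\<close> in every coordinate, then
  exchanging the labels \<open>a\<close> and \<open>b\<close> changes the likelihood of \<open>Y\<close> by a factor of at most \<open>C\<^sup>d\<close> on
  an event of probability at least \<open>c\<^sup>d\<close>, so every estimator errs at \<open>a\<close> with probability at least
  \<open>c\<^sup>d\<close>. Such a \<open>b\<close> exists with probability at least \<open>c\<^sup>d min (n \<sigma>\<^sup>d) 1\<close>.\<close>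

section \<open>One-dimensional Gaussian estimates\<close>

abbreviation gauss :: "real \<Rightarrow> real measure"
  where "gauss s \<equiv> density lborel (\<lambda>x. ennreal (normal_density 0 s x))"

lemma nn_integral_gauss:
  assumes [measurable]: "f \<in> borel_measurable borel"
  shows "(\<integral>\<^sup>+x. f x \<partial>gauss s) = (\<integral>\<^sup>+x. ennreal (normal_density 0 s x) * f x \<partial>lborel)"
  by (subst nn_integral_density) auto

lemma nn_integral_normal_density:
  assumes "0 < s"
  shows "(\<integral>\<^sup>+x. ennreal (normal_density m s x) \<partial>lborel) = 1"
  using assms by (subst nn_integral_eq_integral) auto

text \<open>The standard normal density is at most \<open>1 / sqrt (2 * pi)\<close>, and what
  remains is an unnormalised Gaussian of standard deviation \<open>sqrt 2 * s\<close>. Uniformity in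
  \<open>c\<close> matters: the centre will be random. This is the source of the factor
  \<open>\<sigma> ^ d\<close> in the upper bound.\<close>

lemma gauss_exp_neg_dist_le:
  assumes s: "0 < s"
  shows "(\<integral>\<^sup>+x. ennreal (exp (- (c - x)\<^sup>2 / (4 * s\<^sup>2))) \<partial>gauss 1) \<le> ennreal (sqrt 2 * s)"
proof -
  have ne: "sqrt 2 * s > 0" using s by simp
  have "(\<integral>\<^sup>+x. ennreal (exp (- (c - x)\<^sup>2 / (4 * s\<^sup>2))) \<partial>gauss 1)
      = (\<integral>\<^sup>+x. ennreal (normal_density 0 1 x) * ennreal (exp (- (c - x)\<^sup>2 / (4 * s\<^sup>2))) \<partial>lborel)"
    by (rule nn_integral_gauss) simp
  also have "\<dots> \<le> (\<integral>\<^sup>+x. ennreal (sqrt 2 * s) * ennreal (normal_density c (sqrt 2 * s) x) \<partial>lborel)"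
  proof (rule nn_integral_mono)
    fix x :: real
    have "normal_density 0 1 x * exp (- (c - x)\<^sup>2 / (4 * s\<^sup>2))
        \<le> (1 / sqrt (2 * pi)) * exp (- (c - x)\<^sup>2 / (4 * s\<^sup>2))"
      by (intro mult_right_mono) (auto simp: normal_density_def divide_le_cancel)
    also have "\<dots> = sqrt 2 * s * normal_density c (sqrt 2 * s) x"
      using s by (simp add: normal_density_def power_mult_distrib real_sqrt_mult power2_commute field_simps)
    finally show "ennreal (normal_density 0 1 x) * ennreal (exp (- (c - x)\<^sup>2 / (4 * s\<^sup>2)))
        \<le> ennreal (sqrt 2 * s) * ennreal (normal_density c (sqrt 2 * s) x)"
      using s by (simp add: ennreal_mult'[symmetric] ennreal_mult''[symmetric] ennreal_leI)
  qed
  also have "\<dots> = ennreal (sqrt 2 * s)"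
    by (simp add: nn_integral_cmult nn_integral_normal_density[OF ne])
  finally show ?thesis .
qed

text \<open>The exponents \<open>- 1 / (2 * s\<^sup>2)\<close> and
  \<open>1 / (4 * s\<^sup>2)\<close> add up to that of a Gaussian with doubled variance, so the
  exponential moment needed for the Chernoff bound is a constant free of \<open>s\<close>.\<close>

lemma gauss_exp_square:
  assumes s: "0 < s"
  shows "(\<integral>\<^sup>+z. ennreal (exp (z\<^sup>2 / (4 * s\<^sup>2))) \<partial>gauss s) = ennreal (sqrt 2)"
proof -
  have ne: "sqrt 2 * s > 0" using s by simp
  have "(\<integral>\<^sup>+z. ennreal (exp (z\<^sup>2 / (4 * s\<^sup>2))) \<partial>gauss s)
      = (\<integral>\<^sup>+z. ennreal (normal_density 0 s z) * ennreal (exp (z\<^sup>2 / (4 * s\<^sup>2))) \<partial>lborel)"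
    by (rule nn_integral_gauss) simp
  also have "\<dots> = (\<integral>\<^sup>+z. ennreal (sqrt 2) * ennreal (normal_density 0 (sqrt 2 * s) z) \<partial>lborel)"
  proof (rule nn_integral_cong)
    fix z :: real
    have "exp (- z\<^sup>2 / (2 * s\<^sup>2)) * exp (z\<^sup>2 / (4 * s\<^sup>2)) = exp (- z\<^sup>2 / (4 * s\<^sup>2))"
      using s by (simp add: exp_add[symmetric] field_simps)
    then have "normal_density 0 s z * exp (z\<^sup>2 / (4 * s\<^sup>2)) = 1 / sqrt (2 * pi * s\<^sup>2) * exp (- z\<^sup>2 / (4 * s\<^sup>2))"
      by (simp add: normal_density_def)
    also have "\<dots> = sqrt 2 * normal_density 0 (sqrt 2 * s) z"
      using s by (simp add: normal_density_def power_mult_distrib real_sqrt_mult field_simps)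
    finally show "ennreal (normal_density 0 s z) * ennreal (exp (z\<^sup>2 / (4 * s\<^sup>2)))
        = ennreal (sqrt 2) * ennreal (normal_density 0 (sqrt 2 * s) z)"
      using s by (simp add: ennreal_mult'[symmetric] ennreal_mult''[symmetric])
  qed
  also have "\<dots> = ennreal (sqrt 2)"
    by (simp add: nn_integral_cmult nn_integral_normal_density[OF ne])
  finally show ?thesis .
qed

text \<open>Follows from \<open>pi\<close> < 4 and e at least 2. It turns the normalising constant
  into an exponential, so that later constants combine by adding exponents.\<close>

lemma two_div_sqrt_two_pi: "exp (- (1/2)) \<le> 2 / sqrt (2 * pi)"
proof -
  have "sqrt (2 * pi) \<le> sqrt (4 * exp 1)"
    using pi_less_4 exp_ge_add_one_self[of 1] by simp
  also have "\<dots> = 2 * exp (1/2)"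
    by (simp add: real_sqrt_mult exp_of_nat_mult[symmetric] real_sqrt_unique power2_eq_square exp_add[symmetric])
  finally show ?thesis
    by (simp add: exp_minus field_simps)
qed

text \<open>Length \<open>2 * w\<close> of the interval times the least density on the points of
  modulus at most \<open>c * s\<close>; the extra \<open>1/2\<close> in the exponent pays for
  \<open>2 / sqrt (2 * pi)\<close>. Below it is used with \<open>c = 1\<close> for central intervals
  and \<open>c = 2\<close> for intervals about a point of modulus at most 1.\<close>

lemma emeasure_gauss_ge:
  assumes "0 < s" "0 \<le> w" "\<And>x. \<bar>x - m\<bar> \<le> w \<Longrightarrow> \<bar>x\<bar> \<le> c * s"
  shows "ennreal (w / s * exp (- (c\<^sup>2 + 1) / 2)) \<le> emeasure (gauss s) {x. \<bar>x - m\<bar> \<le> w}"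
proof -
  let ?A = "{m - w..m + w}"
  have A: "{x. \<bar>x - m\<bar> \<le> w} = ?A" by auto
  have "ennreal (w / s * exp (- (c\<^sup>2 + 1) / 2)) \<le> ennreal (exp (- c\<^sup>2 / 2) / sqrt (2 * pi * s\<^sup>2) * (2 * w))"
  proof (rule ennreal_leI)
    have "w / s * exp (- (c\<^sup>2 + 1) / 2) = w / s * exp (- c\<^sup>2 / 2) * exp (- (1/2))"
      by (simp add: exp_add[symmetric] field_simps)
    also have "\<dots> \<le> w / s * exp (- c\<^sup>2 / 2) * (2 / sqrt (2 * pi))"
      using assms by (intro mult_left_mono two_div_sqrt_two_pi) auto
    finally show "w / s * exp (- (c\<^sup>2 + 1) / 2) \<le> exp (- c\<^sup>2 / 2) / sqrt (2 * pi * s\<^sup>2) * (2 * w)"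
      using assms by (simp add: real_sqrt_mult field_simps)
  qed
  also have "\<dots> = (\<integral>\<^sup>+x. ennreal (exp (- c\<^sup>2 / 2) / sqrt (2 * pi * s\<^sup>2)) * indicator ?A x \<partial>lborel)"
    using assms(2) by (subst nn_integral_cmult_indicator) (simp_all add: ennreal_mult''[symmetric] del: ennreal_mult'')
  also have "\<dots> \<le> (\<integral>\<^sup>+x. ennreal (normal_density 0 s x) * indicator ?A x \<partial>lborel)"
  proof (intro nn_integral_mono)
    fix x :: real
    show "ennreal (exp (- c\<^sup>2 / 2) / sqrt (2 * pi * s\<^sup>2)) * indicator ?A x
        \<le> ennreal (normal_density 0 s x) * indicator ?A x"
    proof (cases "x \<in> ?A")
      case True
      then have "\<bar>x\<bar> \<le> c * s" using assms(3)[of x] by auto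
      then have "x\<^sup>2 \<le> c\<^sup>2 * s\<^sup>2"
        by (metis power_mult_distrib abs_ge_zero power2_abs power_mono)
      then have "- (c\<^sup>2 / 2) \<le> - (x\<^sup>2 / (2 * s\<^sup>2))"
        using assms(1) by (simp add: field_simps)
      then show ?thesis
        using True assms(1) by (auto intro!: ennreal_leI divide_right_mono simp: normal_density_def)
    qed simp
  qed
  also have "\<dots> = emeasure (gauss s) ?A"
    by (subst emeasure_density) auto
  finally show ?thesis by (simp add: A)
qed

text \<open>Where \<open>\<bar>z\<bar> \<le> s\<close>, the Gaussian density changes by a factor of at most \<open>exp 2\<close> under
  a shift by at most \<open>s\<close>.\<close>

lemma gauss_shift_le:
  assumes s: "0 < s" and c: "\<bar>c\<bar> \<le> s" and [measurable]: "h \<in> borel_measurable borel"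
  shows "(\<integral>\<^sup>+z. indicator {z. \<bar>z\<bar> \<le> s} z * h (z + c) \<partial>gauss s) \<le> ennreal (exp 2) * (\<integral>\<^sup>+z. h z \<partial>gauss s)"
proof -
  let ?\<phi> = "\<lambda>z. ennreal (normal_density 0 s z)"
  have "(\<integral>\<^sup>+z. indicator {z. \<bar>z\<bar> \<le> s} z * h (z + c) \<partial>gauss s)
      = (\<integral>\<^sup>+z. ?\<phi> z * (indicator {z. \<bar>z\<bar> \<le> s} z * h (z + c)) \<partial>lborel)"
    by (rule nn_integral_gauss) measurable
  \<comment> \<open>The form \<open>c + 1 * z\<close> is the one expected by the affine substitution
    rule for \<open>lborel\<close>.\<close>
  also have "\<dots> \<le> (\<integral>\<^sup>+z. ennreal (exp 2) * (?\<phi> (c + 1 * z) * h (c + 1 * z)) \<partial>lborel)"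
  proof (intro nn_integral_mono)
    fix z :: real
    show "?\<phi> z * (indicator {z. \<bar>z\<bar> \<le> s} z * h (z + c)) \<le> ennreal (exp 2) * (?\<phi> (c + 1 * z) * h (c + 1 * z))"
    proof (cases "\<bar>z\<bar> \<le> s")
      case True
      \<comment> \<open>\<open>c + z\<close> stays within \<open>2 * s\<close>, so its Gaussian
        exponent is at least -2, while that of \<open>z\<close> is at most 0: the densities differ
        by a factor of at most \<open>exp 2\<close>.\<close>
      then have "\<bar>c + z\<bar> \<le> 2 * s" using c by linarith
      then have "(c + z)\<^sup>2 \<le> (2 * s)\<^sup>2"
        by (metis abs_ge_zero power2_abs power_mono)
      then have "- (z\<^sup>2 / (2 * s\<^sup>2)) \<le> 2 + - ((c + z)\<^sup>2 / (2 * s\<^sup>2))"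
        using s zero_le_power2[of z] by (simp add: field_simps power_mult_distrib add_increasing)
      then have "exp (- (z\<^sup>2 / (2 * s\<^sup>2))) \<le> exp 2 * exp (- ((c + z)\<^sup>2 / (2 * s\<^sup>2)))"
        by (simp add: exp_add[symmetric])
      then have "normal_density 0 s z \<le> exp 2 * normal_density 0 s (c + z)"
        using s by (simp add: normal_density_def divide_right_mono)
      then have "?\<phi> z \<le> ennreal (exp 2) * ?\<phi> (c + z)"
        by (simp add: ennreal_mult'[symmetric] ennreal_leI)
      then show ?thesis
        using True by (simp add: add.commute mult_right_mono mult.assoc[symmetric])
    qed simp
  qed
  also have "\<dots> = ennreal (exp 2) * (\<integral>\<^sup>+z. ?\<phi> (c + 1 * z) * h (c + 1 * z) \<partial>lborel)"
    by (rule nn_integral_cmult) measurable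
  also have "(\<integral>\<^sup>+z. ?\<phi> (c + 1 * z) * h (c + 1 * z) \<partial>lborel) = (\<integral>\<^sup>+z. ?\<phi> z * h z \<partial>lborel)"
    by (subst nn_integral_real_affine[of _ 1 c]) auto
  also have "\<dots> = (\<integral>\<^sup>+z. h z \<partial>gauss s)"
    by (rule nn_integral_gauss[symmetric]) measurable
  finally show ?thesis .
qed

text \<open>Lifts a weighted substitution inequality from the factors to a finite product, by
  integrating out one coordinate at a time. The factor inequality is assumed for every measurable
  \<open>g\<close> because it is applied to sections of \<open>h\<close>. It is used twice: for the
  coordinates of a vector, then for the vectors of a configuration.\<close>

lemma (in product_sigma_finite) nn_integral_PiM_subst_le:
  assumes "finite I"
    and "\<And>i. i \<in> I \<Longrightarrow> w i \<in> borel_measurable (M i)"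
    and "\<And>i. i \<in> I \<Longrightarrow> T i \<in> M i \<rightarrow>\<^sub>M M i"
    and "\<And>i g. i \<in> I \<Longrightarrow> g \<in> borel_measurable (M i) \<Longrightarrow>
      (\<integral>\<^sup>+z. w i z * g (T i z) \<partial>M i) \<le> C i * (\<integral>\<^sup>+z. g z \<partial>M i)"
    and "h \<in> borel_measurable (PiM I M)"
  shows "(\<integral>\<^sup>+z. (\<Prod>i\<in>I. w i (z i)) * h (\<lambda>i\<in>I. T i (z i)) \<partial>PiM I M)
    \<le> (\<Prod>i\<in>I. C i) * (\<integral>\<^sup>+z. h z \<partial>PiM I M)"
  using assms
proof (induction I arbitrary: h rule: finite_induct)
  case empty
  then show ?case by (simp add: PiM_empty nn_integral_count_space_finite)
next
  case (insert j I h)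
  note [measurable] = insert.prems(4)
  have [measurable]: "w i \<in> borel_measurable (M i)" "T i \<in> M i \<rightarrow>\<^sub>M M i" if "i \<in> insert j I" for i
    using insert.prems(1,2) that by auto
  have [measurable]: "w j \<in> borel_measurable (M j)" "T j \<in> M j \<rightarrow>\<^sub>M M j"
    using insert.prems(1,2) by auto
  interpret I: finite_product_sigma_finite M I by standard fact
  \<comment> \<open>The induction hypothesis is applied to \<open>H\<close>, that is to
    \<open>h\<close> with the new coordinate already integrated out.\<close>
  define H where "H z = (\<integral>\<^sup>+y. h (z(j := y)) \<partial>M j)" for z
  have [measurable]: "H \<in> borel_measurable (PiM I M)"
    unfolding H_def by measurable
  have w1: "(\<lambda>z. \<Prod>i\<in>I. w i (z i)) \<in> borel_measurable (PiM I M)"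
    by (intro borel_measurable_prod_ennreal measurable_compose[OF measurable_component_singleton]) auto
  have T1: "(\<lambda>z. \<lambda>i\<in>I. T i (z i)) \<in> PiM I M \<rightarrow>\<^sub>M PiM I M"
    by (intro measurable_restrict measurable_compose[OF measurable_component_singleton]) auto
  have m: "(\<lambda>z. (\<Prod>i\<in>insert j I. w i (z i)) * h (\<lambda>i\<in>insert j I. T i (z i)))
      \<in> borel_measurable (PiM (insert j I) M)"
    by (intro borel_measurable_times_ennreal borel_measurable_prod_ennreal
          measurable_compose[OF _ insert.prems(4)] measurable_restrict
          measurable_compose[OF measurable_component_singleton]) auto
  have "(\<integral>\<^sup>+z. (\<Prod>i\<in>insert j I. w i (z i)) * h (\<lambda>i\<in>insert j I. T i (z i)) \<partial>PiM (insert j I) M)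
      = (\<integral>\<^sup>+z. \<integral>\<^sup>+y. (\<Prod>i\<in>insert j I. w i ((z(j := y)) i)) * h (\<lambda>i\<in>insert j I. T i ((z(j := y)) i)) \<partial>M j \<partial>PiM I M)"
    by (rule product_nn_integral_insert[OF insert.hyps m])
  also have "\<dots> \<le> (\<integral>\<^sup>+z. C j * ((\<Prod>i\<in>I. w i (z i)) * H (\<lambda>i\<in>I. T i (z i))) \<partial>PiM I M)"
  proof (rule nn_integral_mono)
    \<comment> \<open>With the old coordinates fixed, the factor inequality for \<open>j\<close>
      applies to the section of \<open>h\<close> at the already transformed point
      \<open>?Tz\<close>.\<close>
    fix z assume z: "z \<in> space (PiM I M)"
    let ?Tz = "\<lambda>i\<in>I. T i (z i)"
    have Tz: "?Tz \<in> space (PiM I M)"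
      using measurable_space[OF T1 z] .
    have hz[measurable]: "(\<lambda>y. h (?Tz(j := y))) \<in> borel_measurable (M j)"
      by (intro measurable_compose[OF _ insert.prems(4)] measurable_fun_upd[where J=I])
         (use Tz insert.hyps in auto)
    have eq: "(\<Prod>i\<in>insert j I. w i ((z(j := y)) i)) * h (\<lambda>i\<in>insert j I. T i ((z(j := y)) i))
        = (\<Prod>i\<in>I. w i (z i)) * (w j y * h (?Tz(j := T j y)))" for y
    proof -
      have "(\<lambda>i\<in>insert j I. T i ((z(j := y)) i)) = ?Tz(j := T j y)"
        using insert.hyps by (auto simp: fun_eq_iff)
      moreover have "(\<Prod>i\<in>I. w i ((z(j := y)) i)) = (\<Prod>i\<in>I. w i (z i))"
        using insert.hyps by (intro prod.cong) auto
      ultimately show ?thesis using insert.hyps by (simp add: mult_ac)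
    qed
    have "(\<integral>\<^sup>+y. (\<Prod>i\<in>insert j I. w i ((z(j := y)) i)) * h (\<lambda>i\<in>insert j I. T i ((z(j := y)) i)) \<partial>M j)
        = (\<Prod>i\<in>I. w i (z i)) * (\<integral>\<^sup>+y. w j y * h (?Tz(j := T j y)) \<partial>M j)"
      unfolding eq
      by (intro nn_integral_cmult borel_measurable_times_ennreal measurable_compose[OF _ hz]) measurable
    also have "\<dots> \<le> (\<Prod>i\<in>I. w i (z i)) * (C j * (\<integral>\<^sup>+y. h (?Tz(j := y)) \<partial>M j))"
      by (intro mult_left_mono insert.prems(3) hz) auto
    finally show "(\<integral>\<^sup>+y. (\<Prod>i\<in>insert j I. w i ((z(j := y)) i)) * h (\<lambda>i\<in>insert j I. T i ((z(j := y)) i)) \<partial>M j)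
        \<le> C j * ((\<Prod>i\<in>I. w i (z i)) * H ?Tz)"
      by (simp add: H_def mult_ac)
  qed
  also have "\<dots> = C j * (\<integral>\<^sup>+z. (\<Prod>i\<in>I. w i (z i)) * H (\<lambda>i\<in>I. T i (z i)) \<partial>PiM I M)"
    using w1 T1 by (intro nn_integral_cmult) measurable
  also have "\<dots> \<le> C j * ((\<Prod>i\<in>I. C i) * (\<integral>\<^sup>+z. H z \<partial>PiM I M))"
    using insert.prems by (intro mult_left_mono insert.IH) auto
  also have "(\<integral>\<^sup>+z. H z \<partial>PiM I M) = (\<integral>\<^sup>+z. h z \<partial>PiM (insert j I) M)"
    unfolding H_def by (rule product_nn_integral_insert[symmetric]) (use insert in auto)
  finally show ?case
    using insert.hyps by (simp add: mult_ac)
qed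

section \<open>Gaussian vectors\<close>

lemma prob_space_gauss: "0 < s \<Longrightarrow> prob_space (gauss s)"
  by (rule prob_space_normal_density)

lemma product_prob_space_gauss: "0 < s \<Longrightarrow> product_prob_space (\<lambda>_. gauss s)"
  by (intro product_prob_spaceI prob_space_gauss)

lemma prob_space_gauss_vec: "0 < s \<Longrightarrow> prob_space (gauss_vec d s)"
  unfolding gauss_vec_def by (intro prob_space_PiM prob_space_gauss)

lemma product_prob_space_gauss_vec: "0 < s \<Longrightarrow> product_prob_space (\<lambda>_. gauss_vec d s)"
  by (intro product_prob_spaceI prob_space_gauss_vec)

lemma sets_gauss_vec [measurable_cong]: "sets (gauss_vec d s) = sets (\<Pi>\<^sub>M k\<in>{1..d}. borel)"
  unfolding gauss_vec_def by (intro sets_PiM_cong) auto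

lemma space_gauss_vec: "space (gauss_vec d s) = extensional {1..d}"
  by (simp add: gauss_vec_def space_PiM PiE_def)

lemma measurable_gauss_vec_component [measurable]:
  "k \<in> {1..d} \<Longrightarrow> (\<lambda>x. x k) \<in> borel_measurable (gauss_vec d s)"
  by measurable

abbreviation gauss_pts :: "nat \<Rightarrow> nat \<Rightarrow> real \<Rightarrow> (nat \<Rightarrow> nat \<Rightarrow> real) measure"
  where "gauss_pts n d s \<equiv> \<Pi>\<^sub>M i\<in>{1..n}. gauss_vec d s"

lemma sets_gauss_pts [measurable_cong]: "sets (gauss_pts n d s) = sets (points_space n d)"
  unfolding points_space_def by (intro sets_PiM_cong sets_gauss_vec) auto

lemma prob_space_gauss_pts: "0 < s \<Longrightarrow> prob_space (gauss_pts n d s)"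
  by (intro prob_space_PiM prob_space_gauss_vec)

lemma gauss_vec_exp_neg_dist_le:
  assumes s: "0 < s"
  shows "(\<integral>\<^sup>+x. (\<Prod>k=1..d. ennreal (exp (- (c k - x k)\<^sup>2 / (4 * s\<^sup>2)))) \<partial>gauss_vec d 1) \<le> ennreal (sqrt 2 * s) ^ d"
proof -
  interpret product_prob_space "\<lambda>_::nat. gauss 1" by (rule product_prob_space_gauss) simp
  have "(\<integral>\<^sup>+x. (\<Prod>k=1..d. ennreal (exp (- (c k - x k)\<^sup>2 / (4 * s\<^sup>2)))) \<partial>gauss_vec d 1)
      = (\<Prod>k=1..d. \<integral>\<^sup>+x. ennreal (exp (- (c k - x)\<^sup>2 / (4 * s\<^sup>2))) \<partial>gauss 1)"
    unfolding gauss_vec_def by (rule product_nn_integral_prod) auto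
  also have "\<dots> \<le> (\<Prod>k=1..d. ennreal (sqrt 2 * s))"
    by (intro prod_mono_ennreal gauss_exp_neg_dist_le s)
  finally show ?thesis by simp
qed

lemma gauss_vec_exp_square:
  assumes s: "0 < s"
  shows "(\<integral>\<^sup>+z. (\<Prod>k=1..d. ennreal (exp ((z k)\<^sup>2 / (4 * s\<^sup>2)))) \<partial>gauss_vec d s) = ennreal (sqrt 2) ^ d"
proof -
  interpret product_prob_space "\<lambda>_::nat. gauss s" by (rule product_prob_space_gauss) fact
  have "(\<integral>\<^sup>+z. (\<Prod>k=1..d. ennreal (exp ((z k)\<^sup>2 / (4 * s\<^sup>2)))) \<partial>gauss_vec d s)
      = (\<Prod>k=1..d. \<integral>\<^sup>+z. ennreal (exp (z\<^sup>2 / (4 * s\<^sup>2))) \<partial>gauss s)"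
    unfolding gauss_vec_def by (rule product_nn_integral_prod) auto
  then show ?thesis by (simp add: gauss_exp_square[OF s])
qed

text \<open>The closed ball of radius \<open>w\<close> about \<open>m\<close> in the maximum norm.
  As a product of intervals it has a Gaussian measure that factorises, which a Euclidean ball would
  not; extensionality makes it a subset of the underlying space.\<close>

definition cube :: "nat \<Rightarrow> (nat \<Rightarrow> real) \<Rightarrow> real \<Rightarrow> (nat \<Rightarrow> real) set"
  where "cube d m w = {x \<in> extensional {1..d}. \<forall>k\<in>{1..d}. \<bar>x k - m k\<bar> \<le> w}"

lemma cube_eq_PiE: "cube d m w = (\<Pi>\<^sub>E k\<in>{1..d}. {x. \<bar>x - m k\<bar> \<le> w})"
  by (auto simp: cube_def PiE_def)

lemma cube_sets [measurable]: "cube d m w \<in> sets (gauss_vec d s)"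
  unfolding cube_eq_PiE gauss_vec_def by (intro sets_PiM_I_finite) auto

lemma emeasure_gauss_vec_cube_ge:
  assumes "0 < s" "0 \<le> w" "\<And>k x. k \<in> {1..d} \<Longrightarrow> \<bar>x - m k\<bar> \<le> w \<Longrightarrow> \<bar>x\<bar> \<le> c * s"
  shows "ennreal (w / s * exp (- (c\<^sup>2 + 1) / 2)) ^ d \<le> emeasure (gauss_vec d s) (cube d m w)"
proof -
  interpret product_prob_space "\<lambda>_::nat. gauss s" by (rule product_prob_space_gauss) fact
  have "ennreal (w / s * exp (- (c\<^sup>2 + 1) / 2)) ^ d = (\<Prod>k=1..d. ennreal (w / s * exp (- (c\<^sup>2 + 1) / 2)))"
    by simp
  also have "\<dots> \<le> (\<Prod>k=1..d. emeasure (gauss s) {x. \<bar>x - m k\<bar> \<le> w})"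
    by (intro prod_mono_ennreal emeasure_gauss_ge assms) auto
  also have "\<dots> = emeasure (gauss_vec d s) (cube d m w)"
    unfolding gauss_vec_def cube_eq_PiE by (rule emeasure_PiM[symmetric]) auto
  finally show ?thesis .
qed

lemma gauss_vec_shift_le:
  assumes s: "0 < s" and c: "\<And>k. k \<in> {1..d} \<Longrightarrow> \<bar>c k\<bar> \<le> s"
    and h: "h \<in> borel_measurable (gauss_vec d s)"
  shows "(\<integral>\<^sup>+z. indicator (cube d (\<lambda>_. 0) s) z * h (\<lambda>k\<in>{1..d}. z k + c k) \<partial>gauss_vec d s)
    \<le> ennreal (exp 2) ^ d * (\<integral>\<^sup>+z. h z \<partial>gauss_vec d s)"
proof -
  interpret product_prob_space "\<lambda>_::nat. gauss s" by (rule product_prob_space_gauss) fact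
  have "(\<integral>\<^sup>+z. indicator (cube d (\<lambda>_. 0) s) z * h (\<lambda>k\<in>{1..d}. z k + c k) \<partial>gauss_vec d s)
      = (\<integral>\<^sup>+z. (\<Prod>k=1..d. indicator {z. \<bar>z\<bar> \<le> s} (z k)) * h (\<lambda>k\<in>{1..d}. z k + c k) \<partial>gauss_vec d s)"
  proof (intro nn_integral_cong arg_cong2[where f="(*)"] refl)
    fix z assume z: "z \<in> space (gauss_vec d s)"
    show "indicator (cube d (\<lambda>_. 0) s) z = (\<Prod>k=1..d. indicator {z. \<bar>z\<bar> \<le> s} (z k) :: ennreal)"
    proof (cases "z \<in> cube d (\<lambda>_. 0) s")
      case True
      then show ?thesis by (auto simp: cube_def)
    next
      case False
      \<comment> \<open>\<open>z\<close> lies in the space and is thus extensional, so leaving the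
        cube means that some coordinate is too large; its factor annihilates the product.\<close>
      then obtain k where "k \<in> {1..d}" "\<not> \<bar>z k\<bar> \<le> s" using z by (auto simp: cube_def space_gauss_vec)
      then show ?thesis using False by (auto simp: indicator_def intro!: prod_zero)
    qed
  qed
  also have "\<dots> \<le> (\<Prod>k=1..d. ennreal (exp 2)) * (\<integral>\<^sup>+z. h z \<partial>gauss_vec d s)"
    using h unfolding gauss_vec_def
    by (intro nn_integral_PiM_subst_le gauss_shift_le s c) auto
  finally show ?thesis by simp
qed

text \<open>Only the points indexed by \<open>J\<close> move, so only they are truncated and only
  they pay the factor \<open>exp 2\<close> per coordinate. The cost does not grow with
  \<open>n\<close>, which is what makes swapping two labels cheap.\<close>

lemma gauss_pts_shift_le:
  assumes s: "0 < s" and J: "J \<subseteq> {1..n}"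
    and v: "\<And>l k. l \<in> J \<Longrightarrow> k \<in> {1..d} \<Longrightarrow> \<bar>v l k\<bar> \<le> s" "\<And>l k. l \<notin> J \<Longrightarrow> v l k = 0"
    and h: "h \<in> borel_measurable (gauss_pts n d s)"
  shows "(\<integral>\<^sup>+Z. (\<Prod>l\<in>J. indicator (cube d (\<lambda>_. 0) s) (Z l)) * h (\<lambda>l\<in>{1..n}. \<lambda>k\<in>{1..d}. Z l k + v l k) \<partial>gauss_pts n d s)
    \<le> ennreal (exp 2) ^ (d * card J) * (\<integral>\<^sup>+Z. h Z \<partial>gauss_pts n d s)"
proof -
  interpret product_prob_space "\<lambda>_::nat. gauss_vec d s" by (rule product_prob_space_gauss_vec) fact
  \<comment> \<open>Writing the product over all indices, with factor 1 outside \<open>J\<close>,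
    brings it into the form of the substitution inequality for products.\<close>
  have restrict: "(\<Prod>l\<in>J. f l) = (\<Prod>l=1..n. if l \<in> J then f l else 1)" for f :: "nat \<Rightarrow> ennreal"
    using prod.inter_restrict[of "{1..n}" f J] J by (simp add: Int_absorb1)
  let ?w = "\<lambda>l z. if l \<in> J then indicator (cube d (\<lambda>_. 0) s) z else 1 :: ennreal"
  have "(\<integral>\<^sup>+Z. (\<Prod>l=1..n. ?w l (Z l)) * h (\<lambda>l\<in>{1..n}. \<lambda>k\<in>{1..d}. Z l k + v l k) \<partial>gauss_pts n d s)
    \<le> (\<Prod>l=1..n. if l \<in> J then ennreal (exp 2) ^ d else 1) * (\<integral>\<^sup>+Z. h Z \<partial>gauss_pts n d s)"
  proof (rule nn_integral_PiM_subst_le[where w="?w" and T="\<lambda>l z. \<lambda>k\<in>{1..d}. z k + v l k"])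
    fix l and g :: "(nat \<Rightarrow> real) \<Rightarrow> ennreal" assume g: "g \<in> borel_measurable (gauss_vec d s)"
    show "(\<integral>\<^sup>+z. ?w l z * g (\<lambda>k\<in>{1..d}. z k + v l k) \<partial>gauss_vec d s)
        \<le> (if l \<in> J then ennreal (exp 2) ^ d else 1) * (\<integral>\<^sup>+z. g z \<partial>gauss_vec d s)"
    proof (cases "l \<in> J")
      case True
      then show ?thesis using gauss_vec_shift_le[OF s v(1)[OF True] g] by simp
    next
      case False
      \<comment> \<open>A zero shift leaves \<open>z\<close> unchanged because points of the space
        are extensional.\<close>
      have "(\<lambda>k\<in>{1..d}. z k + v l k) = z" if "z \<in> space (gauss_vec d s)" for z
        using that False v(2) by (simp add: space_gauss_vec extensional_restrict)
      then show ?thesis using False by (auto intro!: eq_refl nn_integral_cong)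
    qed
  next
    fix l
    show "(\<lambda>z. \<lambda>k\<in>{1..d}. z k + v l k) \<in> gauss_vec d s \<rightarrow>\<^sub>M gauss_vec d s"
      unfolding measurable_cong_sets[OF refl sets_gauss_vec]
      by (intro measurable_restrict) measurable
  qed (use h in auto)
  then show ?thesis
    unfolding restrict[symmetric] by (simp add: power_mult)
qed

lemma emeasure_gauss_pts_cubes_ge:
  assumes s: "0 < s" and J: "J \<subseteq> {1..n}"
  shows "ennreal (exp (- 1)) ^ (d * card J)
    \<le> (\<integral>\<^sup>+Z. (\<Prod>l\<in>J. indicator (cube d (\<lambda>_. 0) s) (Z l)) \<partial>gauss_pts n d s)"
proof -
  interpret product_prob_space "\<lambda>_::nat. gauss_vec d s" by (rule product_prob_space_gauss_vec) fact
  have restrict: "(\<Prod>l\<in>J. f l) = (\<Prod>l=1..n. if l \<in> J then f l else 1)" for f :: "nat \<Rightarrow> ennreal"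
    using prod.inter_restrict[of "{1..n}" f J] J by (simp add: Int_absorb1)
  let ?w = "\<lambda>l z. if l \<in> J then indicator (cube d (\<lambda>_. 0) s) z else 1 :: ennreal"
  have "ennreal (exp (- 1)) ^ (d * card J) = (\<Prod>l\<in>J. ennreal (exp (- 1)) ^ d)"
    by (simp add: power_mult)
  \<comment> \<open>Centre 0 and radius \<open>s\<close> allow \<open>c = 1\<close>, for which the
    factor per coordinate is \<open>exp (- 1)\<close>.\<close>
  also have "\<dots> \<le> (\<Prod>l\<in>J. emeasure (gauss_vec d s) (cube d (\<lambda>_. 0) s))"
    using emeasure_gauss_vec_cube_ge[OF s, of s d "\<lambda>_. 0" 1] s
    by (intro prod_mono_ennreal) auto
  also have "\<dots> = (\<Prod>l=1..n. \<integral>\<^sup>+z. ?w l z \<partial>gauss_vec d s)"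
    unfolding restrict by (intro prod.cong) (auto simp: prob_space.emeasure_space_1[OF prob_space_gauss_vec[OF s]])
  also have "\<dots> = (\<integral>\<^sup>+Z. (\<Prod>l=1..n. ?w l (Z l)) \<partial>gauss_pts n d s)"
    by (rule product_nn_integral_prod[symmetric]) auto
  finally show ?thesis unfolding restrict .
qed

section \<open>The risk as an iterated integral\<close>

lemma finite_perms: "finite (perms n)"
  unfolding perms_def by (rule finite_permutations) simp

lemma perms_nonempty: "perms n \<noteq> {}"
  using permutes_id[of "{1..n}"] by (auto simp only: perms_def)

lemma perms_mem: "p \<in> perms n \<Longrightarrow> i \<in> {1..n} \<Longrightarrow> p i \<in> {1..n}"
  by (simp only: perms_def mem_Collect_eq permutes_in_image)

lemma d_H_nonneg: "0 \<le> d_H n p q"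
  unfolding d_H_def by (intro sum_nonneg) auto

lemma d_H_eq_card: "d_H n p q = real (card {j\<in>{1..n}. p j \<noteq> q j})"
proof -
  have "{1..n} \<inter> {j. p j \<noteq> q j} = {j\<in>{1..n}. p j \<noteq> q j}" by blast
  then show ?thesis by (simp add: d_H_def sum_of_bool_eq)
qed

lemma d_H_le: "d_H n p q \<le> real n"
proof -
  have "card {j\<in>{1..n}. p j \<noteq> q j} \<le> card {1..n}" by (intro card_mono) auto
  then show ?thesis by (simp add: d_H_eq_card)
qed

lemma ennreal_d_H: "ennreal (d_H n p q) = (\<Sum>j=1..n. of_bool (p j \<noteq> q j))"
proof -
  have "ennreal (d_H n p q) = (\<Sum>j=1..n. ennreal (of_bool (p j \<noteq> q j)))"
    unfolding d_H_def by (rule sum_ennreal[symmetric]) simp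
  also have "\<dots> = (\<Sum>j=1..n. of_bool (p j \<noteq> q j))"
    by (intro sum.cong) (auto simp: of_bool_def)
  finally show ?thesis .
qed

section \<open>Measurability of the observations and of the loss\<close>

lemma measurable_points_coord [measurable]:
  "i \<in> {1..n} \<Longrightarrow> k \<in> {1..d} \<Longrightarrow> (\<lambda>X. X i k) \<in> borel_measurable (points_space n d)"
  unfolding points_space_def
  by (rule measurable_compose[where g="\<lambda>x. x k", OF measurable_component_singleton]) auto

text \<open>Formulated along arbitrary measurable maps \<open>f\<close> and \<open>g\<close>, so
  that it serves on the joint space as well as for a fixed configuration \<open>X\<close>, where
  \<open>f\<close> is constant. The permutation is fixed here and made random only in
  \<open>borel_measurable_model_loss\<close>.\<close>

lemma measurable_Y_obs:
  assumes p: "p \<in> perms n"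
    and f: "f \<in> M \<rightarrow>\<^sub>M points_space n d" and g: "g \<in> M \<rightarrow>\<^sub>M points_space n d"
  shows "(\<lambda>w. Y_obs n d (f w) (g w) p) \<in> M \<rightarrow>\<^sub>M points_space n d"
  unfolding Y_obs_def points_space_def
proof (intro measurable_restrict borel_measurable_add)
  fix i k assume i: "i \<in> {1..n}" and k: "k \<in> {1..d}"
  show "(\<lambda>w. f w (p i) k) \<in> borel_measurable M"
    by (rule measurable_compose[OF f measurable_points_coord[OF perms_mem[OF p i] k]])
  show "(\<lambda>w. g w i k) \<in> borel_measurable M"
    by (rule measurable_compose[OF g measurable_points_coord[OF i k]])
qed

lemma measurable_estimate:
  assumes "est \<in> estimators n d" "p \<in> perms n"
    and "f \<in> M \<rightarrow>\<^sub>M points_space n d" "g \<in> M \<rightarrow>\<^sub>M points_space n d"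
  shows "(\<lambda>w. est (f w, Y_obs n d (f w) (g w) p)) \<in> M \<rightarrow>\<^sub>M count_space (perms n)"
  by (rule measurable_compose[OF measurable_Pair[OF assms(3) measurable_Y_obs[OF assms(2-4)]]
        assms(1)[unfolded estimators_def]])

lemma borel_measurable_loss:
  assumes "est \<in> estimators n d" "p \<in> perms n"
    and "f \<in> M \<rightarrow>\<^sub>M points_space n d" "g \<in> M \<rightarrow>\<^sub>M points_space n d"
  shows "(\<lambda>w. d_H n (est (f w, Y_obs n d (f w) (g w) p)) p) \<in> borel_measurable M"
  by (rule measurable_compose[OF measurable_estimate[OF assms]]) simp

lemma prob_space_model:
  assumes "0 < s"
  shows "prob_space (model n d s)"
proof -
  interpret X: prob_space "gauss_pts n d 1" by (rule prob_space_gauss_pts) simp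
  interpret Z: prob_space "gauss_pts n d s" by (rule prob_space_gauss_pts) fact
  interpret U: prob_space "uniform_count_measure (perms n)"
    by (rule prob_space_uniform_count_measure[OF finite_perms perms_nonempty])
  interpret ZU: pair_prob_space "gauss_pts n d s" "uniform_count_measure (perms n)" ..
  interpret XZU: pair_prob_space "gauss_pts n d 1" "gauss_pts n d s \<Otimes>\<^sub>M uniform_count_measure (perms n)" ..
  show ?thesis unfolding model_def by (rule XZU.prob_space_axioms)
qed

text \<open>Measurability holds for each fixed permutation, and the random permutation ranges over a
  finite set, so it may be substituted.\<close>

lemma borel_measurable_model_loss:
  assumes est: "est \<in> estimators n d"
  shows "(\<lambda>(X, Z, p). d_H n (est (X, Y_obs n d X Z p)) p) \<in> borel_measurable (model n d s)"
proof -
  have X: "fst \<in> model n d s \<rightarrow>\<^sub>M points_space n d"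
    unfolding model_def measurable_cong_sets[OF refl sets_gauss_pts[of n d 1, symmetric]]
    by (rule measurable_fst)
  have Z: "(\<lambda>w. fst (snd w)) \<in> model n d s \<rightarrow>\<^sub>M points_space n d"
    unfolding model_def measurable_cong_sets[OF refl sets_gauss_pts[of n d s, symmetric]]
    by (rule measurable_compose[OF measurable_snd measurable_fst])
  have P: "(\<lambda>w. snd (snd w)) \<in> model n d s \<rightarrow>\<^sub>M count_space (perms n)"
    unfolding model_def measurable_cong_sets[OF refl sets_uniform_count_measure_count_space[symmetric]]
    by (rule measurable_compose[OF measurable_snd measurable_snd])
  define F where "F p w = d_H n (est (fst w, Y_obs n d (fst w) (fst (snd w)) p)) p" for p and w :: "_ \<times> _ \<times> (nat \<Rightarrow> nat)"
  have F: "F p \<in> borel_measurable (model n d s)" if "p \<in> perms n" for p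
    unfolding F_def[abs_def] by (rule borel_measurable_loss[OF est that X Z])
  have "(\<lambda>w. F (snd (snd w)) w) \<in> borel_measurable (model n d s)"
    by (rule measurable_compose_countable'[OF F P countable_finite[OF finite_perms]])
  also have "(\<lambda>w. F (snd (snd w)) w) = (\<lambda>(X, Z, p). d_H n (est (X, Y_obs n d X Z p)) p)"
    unfolding F_def by (rule ext) (simp add: split_beta)
  finally show ?thesis .
qed

text \<open>Passing to nonnegative integrals removes integrability questions from all later
  interchanges. With \<open>X\<close> outermost, the lower bound can condition on the
  configuration.\<close>

lemma ennreal_risk:
  assumes s: "0 < s" and est: "est \<in> estimators n d"
  shows "ennreal (risk n d s est) = (\<integral>\<^sup>+X. \<integral>\<^sup>+Z. (\<Sum>p\<in>perms n.
      ennreal (1 / real (card (perms n))) * ennreal (d_H n (est (X, Y_obs n d X Z p)) p))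
      \<partial>gauss_pts n d s \<partial>gauss_pts n d 1)"
proof -
  let ?L = "\<lambda>(X, Z, p). d_H n (est (X, Y_obs n d X Z p)) p"
  let ?U = "uniform_count_measure (perms n)"
  interpret model: prob_space "model n d s" by (rule prob_space_model) fact
  interpret Z: prob_space "gauss_pts n d s" by (rule prob_space_gauss_pts) fact
  interpret U: prob_space ?U
    by (rule prob_space_uniform_count_measure[OF finite_perms perms_nonempty])
  interpret ZU: pair_prob_space "gauss_pts n d s" ?U ..
  define F where "F w = ennreal (?L w)" for w
  have meas: "F \<in> borel_measurable (gauss_pts n d 1 \<Otimes>\<^sub>M (gauss_pts n d s \<Otimes>\<^sub>M ?U))"
    unfolding F_def using borel_measurable_model_loss[OF est, of s] unfolding model_def
    by (rule measurable_compose[OF _ measurable_ennreal])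
  have L: "0 \<le> ?L w" "norm (?L w) \<le> real n" for w
    by (simp_all add: split_beta d_H_nonneg d_H_le)
  \<comment> \<open>The loss is bounded by \<open>n\<close> on a probability space; without
    integrability the Bochner integral would be 0 by convention and the identity could fail.\<close>
  have "integrable (model n d s) ?L"
    by (rule model.integrable_const_bound[OF AE_I2[OF L(2)] borel_measurable_model_loss[OF est]])
  then have "ennreal (risk n d s est) = (\<integral>\<^sup>+w. F w \<partial>model n d s)"
    unfolding risk_def F_def by (rule nn_integral_eq_integral[OF _ AE_I2[OF L(1)], symmetric])
  also have "\<dots> = (\<integral>\<^sup>+X. \<integral>\<^sup>+zp. F (X, zp) \<partial>(gauss_pts n d s \<Otimes>\<^sub>M ?U) \<partial>gauss_pts n d 1)"
    unfolding model_def by (rule ZU.nn_integral_fst[OF meas, symmetric])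
  also have "\<dots> = (\<integral>\<^sup>+X. \<integral>\<^sup>+Z. \<integral>\<^sup>+p. F (X, Z, p) \<partial>?U \<partial>gauss_pts n d s \<partial>gauss_pts n d 1)"
  proof (rule nn_integral_cong)
    fix X assume "X \<in> space (gauss_pts n d 1)"
    then have "(\<lambda>zp. F (X, zp)) \<in> borel_measurable (gauss_pts n d s \<Otimes>\<^sub>M ?U)"
      by (intro measurable_compose[OF measurable_Pair1' meas])
    then show "(\<integral>\<^sup>+zp. F (X, zp) \<partial>(gauss_pts n d s \<Otimes>\<^sub>M ?U)) = (\<integral>\<^sup>+Z. \<integral>\<^sup>+p. F (X, Z, p) \<partial>?U \<partial>gauss_pts n d s)"
      by (rule U.nn_integral_fst[symmetric])
  qed
  also have "\<dots> = (\<integral>\<^sup>+X. \<integral>\<^sup>+Z. (\<Sum>p\<in>perms n. ennreal (1 / real (card (perms n))) * F (X, Z, p))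
      \<partial>gauss_pts n d s \<partial>gauss_pts n d 1)"
    by (simp add: uniform_count_measure_def nn_integral_point_measure_finite finite_perms)
  finally show ?thesis by (simp add: F_def)
qed

section \<open>The lower bound\<close>

text \<open>Swapping the labels \<open>a\<close> and \<open>b\<close> in \<open>p\<close> amounts, for fixed observations, to a small shift of
  the noise, and an estimate cannot be right about \<open>a\<close> for both permutations.\<close>

lemma neighbour_error_ge:
  fixes n d est a
  defines "e \<equiv> \<lambda>X p Z. of_bool (est (X, Y_obs n d X Z p) (inv p a) \<noteq> a) :: ennreal"
  assumes s: "0 < s" and est: "est \<in> estimators n d" and X: "X \<in> space (points_space n d)"
    and a: "a \<in> {1..n}" and b: "b \<in> {1..n}" "b \<noteq> a"
    and close: "\<And>k. k \<in> {1..d} \<Longrightarrow> \<bar>X b k - X a k\<bar> \<le> s"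
  shows "ennreal (exp (- (6 * real d)) / 2)
    \<le> (\<Sum>p\<in>perms n. ennreal (1 / real (card (perms n))) * (\<integral>\<^sup>+Z. e X p Z \<partial>gauss_pts n d s))"
proof -
  let ?N = "card (perms n)"
  let ?\<tau> = "Transposition.transpose a b"
  have N: "0 < real ?N" using finite_perms perms_nonempty by (simp add: card_gt_0_iff)
  have swap_perms: "?\<tau> \<circ> p \<in> perms n" if "p \<in> perms n" for p
    using permutes_compose[OF _ permutes_swap_id[OF a b(1)], of p] that
    by (simp only: perms_def mem_Collect_eq)
  have meas_e: "e X p \<in> borel_measurable (gauss_pts n d s)" if "p \<in> perms n" for p
  proof -
    have "(\<lambda>Z. est (X, Y_obs n d X Z p)) \<in> gauss_pts n d s \<rightarrow>\<^sub>M count_space (perms n)"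
      by (rule measurable_estimate[OF est that measurable_const[OF X] measurable_ident_sets[OF sets_gauss_pts]])
    then show ?thesis unfolding e_def by (rule measurable_compose) simp
  qed
  \<comment> \<open>Two-point argument for a single pair \<open>p\<close> and
    \<open>?\<tau> \<circ> p\<close>: the event that both affected noise vectors lie in the cube has
    mass at least \<open>exp (- 2 * d)\<close>, and it is covered by the errors under the two
    permutations.\<close>
  have step: "ennreal (exp (- 1)) ^ (d * 2)
      \<le> (\<integral>\<^sup>+Z. e X p Z \<partial>gauss_pts n d s) + ennreal (exp 2) ^ (d * 2) * (\<integral>\<^sup>+Z. e X (?\<tau> \<circ> p) Z \<partial>gauss_pts n d s)"
    if p: "p \<in> perms n" for p
  proof -
    define q where "q = ?\<tau> \<circ> p"
    define i j where "i = inv p a" and "j = inv p b"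
    \<comment> \<open>Noise \<open>Z + v\<close> under \<open>q\<close> yields the same observations
      as noise \<open>Z\<close> under \<open>p\<close>, hence the same estimate. Only the indices
      \<open>i\<close> and \<open>j\<close> have nonzero displacement, and there it is the
      difference of \<open>X a\<close> and \<open>X b\<close>.\<close>
    define v where "v l k = X (p l) k - X (q l) k" for l k
    have pp: "p permutes {1..n}" using p by (simp only: perms_def mem_Collect_eq)
    have q: "q \<in> perms n" unfolding q_def by (rule swap_perms[OF p])
    have pi: "p i = a" "p j = b" unfolding i_def j_def using permutes_inverses[OF pp] by auto
    have ij: "i \<in> {1..n}" "j \<in> {1..n}" "i \<noteq> j"
      using permutes_in_image[OF permutes_inv[OF pp]] a b pi by (auto simp only: i_def j_def)
    have inv_q: "inv q a = j"
    proof -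
      have "q permutes {1..n}" using q by (simp only: perms_def mem_Collect_eq)
      moreover have "q j = a" by (simp add: q_def pi)
      ultimately show ?thesis using permutes_inverses(2) by metis
    qed
    let ?shift = "\<lambda>Z. \<lambda>l\<in>{1..n}. \<lambda>k\<in>{1..d}. Z l k + v l k"
    let ?I = "\<lambda>Z. \<Prod>l\<in>{i, j}. indicator (cube d (\<lambda>_. 0) s) (Z l) :: ennreal"
    have "ennreal (exp (- 1)) ^ (d * 2) \<le> (\<integral>\<^sup>+Z. ?I Z \<partial>gauss_pts n d s)"
      using emeasure_gauss_pts_cubes_ge[OF s, of "{i, j}" n d] ij by (simp add: mult_2_right)
    also have "\<dots> \<le> (\<integral>\<^sup>+Z. e X p Z + ?I Z * e X q (?shift Z) \<partial>gauss_pts n d s)"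
    proof (rule nn_integral_mono)
      fix Z assume Z: "Z \<in> space (gauss_pts n d s)"
      have Y: "Y_obs n d X (?shift Z) q = Y_obs n d X Z p"
        by (auto simp: Y_obs_def v_def fun_eq_iff)
      have "est (X, Y_obs n d X Z p) \<in> perms n"
        using measurable_space[OF measurable_estimate[OF est p measurable_const[OF X]
          measurable_ident_sets[OF sets_gauss_pts]] Z] by simp
      then have "inj (est (X, Y_obs n d X Z p))"
        unfolding perms_def by (auto dest: permutes_inj)
      \<comment> \<open>The label \<open>a\<close> belongs at \<open>i\<close> under
        \<open>p\<close> and at \<open>j\<close> under \<open>q\<close>. An injective estimate takes
        the value \<open>a\<close> at most once, so it errs under one of the two.\<close>
      then have "est (X, Y_obs n d X Z p) i \<noteq> a \<or> est (X, Y_obs n d X Z p) j \<noteq> a"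
        using ij(3) by (metis injD)
      then have "e X p Z = 1 \<or> e X q (?shift Z) = 1"
        unfolding e_def Y inv_q i_def[symmetric] by auto
      moreover have "?I Z \<le> 1"
        using ij(3) by (simp add: indicator_def)
      ultimately show "?I Z \<le> e X p Z + ?I Z * e X q (?shift Z)"
        by (auto intro: order_trans[of _ 1] simp: add_increasing)
    qed
    also have "\<dots> = (\<integral>\<^sup>+Z. e X p Z \<partial>gauss_pts n d s) + (\<integral>\<^sup>+Z. ?I Z * e X q (?shift Z) \<partial>gauss_pts n d s)"
    proof (rule nn_integral_add[OF meas_e[OF p]])
      have "?shift \<in> gauss_pts n d s \<rightarrow>\<^sub>M gauss_pts n d s"
        unfolding measurable_cong_sets[OF sets_gauss_pts sets_gauss_pts]
        by (subst (2) points_space_def)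
           (intro measurable_restrict borel_measurable_add measurable_points_coord borel_measurable_const)
      from measurable_compose[OF this meas_e[OF q]]
      have "(\<lambda>Z. e X q (?shift Z)) \<in> borel_measurable (gauss_pts n d s)" .
      moreover have "?I \<in> borel_measurable (gauss_pts n d s)"
        by (intro borel_measurable_prod_ennreal measurable_compose[OF measurable_component_singleton borel_measurable_indicator] cube_sets)
           (use ij in auto)
      ultimately show "(\<lambda>Z. ?I Z * e X q (?shift Z)) \<in> borel_measurable (gauss_pts n d s)"
        by (intro borel_measurable_times_ennreal)
    qed
    \<comment> \<open>Removing the shift costs \<open>exp 2\<close> for each of the \<open>d\<close>
      coordinates of the two moved vectors.\<close>
    also have "(\<integral>\<^sup>+Z. ?I Z * e X q (?shift Z) \<partial>gauss_pts n d s)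
        \<le> ennreal (exp 2) ^ (d * card {i, j}) * (\<integral>\<^sup>+Z. e X q Z \<partial>gauss_pts n d s)"
    proof (rule gauss_pts_shift_le[OF s _ _ _ meas_e[OF q]])
      show "{i, j} \<subseteq> {1..n}" using ij by simp
    next
      fix l k assume "l \<in> {i, j}" "k \<in> {1..d}"
      then show "\<bar>v l k\<bar> \<le> s"
        using close[of k] by (auto simp: v_def q_def pi abs_minus_commute)
    next
      fix l k assume "l \<notin> {i, j}"
      then have "p l \<noteq> a" "p l \<noteq> b"
        using permutes_inverses(2)[OF pp] unfolding i_def j_def by auto
      then show "v l k = 0" by (simp add: v_def q_def)
    qed
    finally show ?thesis using ij(3) by (simp add: q_def mult_2_right)
  qed
  define E where "E = (\<Sum>p\<in>perms n. \<integral>\<^sup>+Z. e X p Z \<partial>gauss_pts n d s)"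
  \<comment> \<open>Composition with the transposition is an involution of \<open>perms n\<close>,
    so under a uniform truth both error terms have the same total.\<close>
  have swap: "(\<Sum>p\<in>perms n. \<integral>\<^sup>+Z. e X (?\<tau> \<circ> p) Z \<partial>gauss_pts n d s) = E"
    unfolding E_def
    by (rule sum.reindex_bij_witness[where i="\<lambda>p. ?\<tau> \<circ> p" and j="\<lambda>p. ?\<tau> \<circ> p"])
       (auto simp: swap_perms comp_assoc[symmetric])
  have "of_nat ?N * ennreal (exp (- 1)) ^ (d * 2)
      \<le> (\<Sum>p\<in>perms n. (\<integral>\<^sup>+Z. e X p Z \<partial>gauss_pts n d s) + ennreal (exp 2) ^ (d * 2) * (\<integral>\<^sup>+Z. e X (?\<tau> \<circ> p) Z \<partial>gauss_pts n d s))"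
    by (rule sum_bounded_below[OF step])
  also have "\<dots> = (1 + ennreal (exp 2) ^ (d * 2)) * E"
    unfolding sum.distrib sum_distrib_left[symmetric] swap E_def[symmetric] by (simp add: distrib_right)
  also have "1 + ennreal (exp 2) ^ (d * 2) = ennreal (1 + exp (4 * real d))"
    by (simp add: ennreal_power exp_of_nat_mult[symmetric] mult.commute)
  also have "\<dots> * E \<le> ennreal (2 * exp (4 * real d)) * E"
    by (intro mult_right_mono ennreal_leI) auto
  finally have "ennreal (real ?N * exp (- (2 * real d))) \<le> ennreal (2 * exp (4 * real d)) * E"
    by (simp add: ennreal_power exp_of_nat_mult[symmetric] ennreal_mult' ennreal_of_nat_eq_real_of_nat mult.commute)
  \<comment> \<open>Dividing by the number of permutations and by \<open>2 * exp (4 * d)\<close>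
    leaves \<open>exp (- 6 * d) / 2\<close>: the 2 d in the exponent comes from the truncation and
    the 4 d from the shift.\<close>
  then have "ennreal (exp (- (4 * real d)) / (2 * real ?N)) * ennreal (real ?N * exp (- (2 * real d)))
      \<le> ennreal (exp (- (4 * real d)) / (2 * real ?N)) * (ennreal (2 * exp (4 * real d)) * E)"
    by (rule mult_left_mono) simp
  also have "ennreal (exp (- (4 * real d)) / (2 * real ?N)) * ennreal (real ?N * exp (- (2 * real d)))
      = ennreal (exp (- (6 * real d)) / 2)"
    using N by (simp add: ennreal_mult'[symmetric] exp_add[symmetric])
  also have "ennreal (exp (- (4 * real d)) / (2 * real ?N)) * (ennreal (2 * exp (4 * real d)) * E)
      = ennreal (1 / real ?N) * E"
    using N by (simp add: mult.assoc[symmetric] ennreal_mult'[symmetric] exp_minus)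
  finally show ?thesis
    by (simp add: E_def sum_distrib_left)
qed

section \<open>The probability that a point has a close neighbour\<close>

definition neighbour_set :: "nat \<Rightarrow> nat \<Rightarrow> real \<Rightarrow> nat \<Rightarrow> (nat \<Rightarrow> nat \<Rightarrow> real) set"
  where "neighbour_set n d s a = {X \<in> space (points_space n d).
    \<exists>b\<in>{1..n} - {a}. \<forall>k\<in>{1..d}. \<bar>X b k - X a k\<bar> \<le> s}"

lemma neighbour_set_sets [measurable]:
  assumes "a \<in> {1..n}"
  shows "neighbour_set n d s a \<in> sets (points_space n d)"
proof -
  have "Measurable.pred (points_space n d) (\<lambda>X. \<bar>X b k - X a k\<bar> \<le> s)"
    if "b \<in> {1..n} - {a}" "k \<in> {1..d}" for b k
  proof -
    have [measurable]: "(\<lambda>X. X b k) \<in> borel_measurable (points_space n d)"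
        "(\<lambda>X. X a k) \<in> borel_measurable (points_space n d)"
      using assms that by (auto intro!: measurable_points_coord)
    show ?thesis by measurable
  qed
  then have "Measurable.pred (points_space n d) (\<lambda>X. \<exists>b\<in>{1..n} - {a}. \<forall>k\<in>{1..d}. \<bar>X b k - X a k\<bar> \<le> s)"
    by (intro pred_intros_finite) auto
  then show ?thesis unfolding neighbour_set_def by (rule predE)
qed

text \<open>Shrinking the radius to \<open>min s 1\<close> keeps the cube about \<open>y\<close>
  inside the region where all coordinates have modulus at most 2. There the density is bounded below
  by a constant per coordinate; the exponent 5/2 is rounded up to 3.\<close>

lemma emeasure_cube_around_ge:
  assumes s: "0 < s" and y: "y \<in> cube d (\<lambda>_. 0) 1"
  shows "ennreal ((min s 1 * exp (- 3)) ^ d) \<le> emeasure (gauss_vec d 1) (cube d y s)"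
proof -
  have "ennreal ((min s 1 * exp (- 3)) ^ d) = ennreal (min s 1 * exp (- 3)) ^ d"
    using s by (simp add: ennreal_power)
  also have "\<dots> \<le> ennreal (min s 1 / 1 * exp (- (2\<^sup>2 + 1) / 2)) ^ d"
    using s by (intro power_mono ennreal_leI mult_mono) auto
  also have "\<dots> \<le> emeasure (gauss_vec d 1) (cube d y (min s 1))"
  proof (rule emeasure_gauss_vec_cube_ge)
    fix k x assume k: "k \<in> {1..d}" and x: "\<bar>x - y k\<bar> \<le> min s 1"
    have "\<bar>y k\<bar> \<le> 1" using y k by (auto simp: cube_def)
    then show "\<bar>x\<bar> \<le> 2 * 1" using x by linarith
  qed (use s in auto)
  also have "\<dots> \<le> emeasure (gauss_vec d 1) (cube d y s)"
    by (intro emeasure_mono cube_sets) (auto simp: cube_def)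
  finally show ?thesis .
qed

text \<open>With probability at least \<open>exp (- d)\<close> the point \<open>X a\<close> lies in
  the central unit cube. Given such a position, the other \<open>n - 1\<close> points are
  independent and each is close with probability at least \<open>p\<close>, so all of them miss with
  probability at most \<open>(1 - p) ^ (n - 1)\<close>.\<close>

lemma emeasure_neighbour_set_ge:
  assumes s: "0 < s" and a: "a \<in> {1..n}"
  shows "ennreal (exp (- real d) * (1 - (1 - (min s 1 * exp (- 3)) ^ d) ^ (n - 1)))
    \<le> emeasure (gauss_pts n d 1) (neighbour_set n d s a)"
proof -
  interpret Vec: prob_space "gauss_vec d 1" by (rule prob_space_gauss_vec) simp
  interpret product_prob_space "\<lambda>_::nat. gauss_vec d 1" "{1..n}" by (rule product_prob_space_gauss_vec) simp
  define p where "p = (min s 1 * exp (- 3)) ^ d"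
  let ?G = "cube d (\<lambda>_. 0) 1"
  let ?I = "{1..n} - {a}"
  have I: "{1..n} = insert a ?I" using a by auto
  define G where "G = {X \<in> space (gauss_pts n d 1). X a \<in> ?G}"
  define B where "B = G - neighbour_set n d s a"
  have "0 \<le> min s 1 * exp (- 3)" using s by simp
  moreover have "min s 1 * exp (- 3) \<le> 1 * 1" by (rule mult_mono) (use s in auto)
  ultimately have p: "0 \<le> p" "p \<le> 1"
    unfolding p_def by (simp_all add: power_le_one)
  have ns[measurable]: "neighbour_set n d s a \<in> sets (gauss_pts n d 1)"
    unfolding sets_gauss_pts by (rule neighbour_set_sets[OF a])
  have "(\<lambda>X. X a) -` ?G \<inter> space (gauss_pts n d 1) \<in> sets (gauss_pts n d 1)"
    by (rule measurable_sets[OF measurable_component_singleton[OF a] cube_sets])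
  also have "(\<lambda>X. X a) -` ?G \<inter> space (gauss_pts n d 1) = G"
    unfolding G_def by blast
  finally have G_sets[measurable]: "G \<in> sets (gauss_pts n d 1)" .
  have B_sets[measurable]: "B \<in> sets (gauss_pts n d 1)"
    unfolding B_def by (intro sets.Diff G_sets ns)
  have eG: "emeasure (gauss_pts n d 1) G = emeasure (gauss_vec d 1) ?G"
    unfolding G_def by (rule emeasure_PiM_Collect_single[OF a cube_sets])
  have "emeasure (gauss_pts n d 1) B = (\<integral>\<^sup>+X. indicator B X \<partial>gauss_pts n d 1)"
    by (rule nn_integral_indicator[OF B_sets, symmetric])
  \<comment> \<open>Coordinate \<open>a\<close> is integrated last: for fixed \<open>y\<close> the
    remaining points must all avoid the fixed cube about \<open>y\<close>, and the inner integral
    factorises.\<close>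
  also have "\<dots> = (\<integral>\<^sup>+y. \<integral>\<^sup>+X. indicator B (X(a := y)) \<partial>PiM ?I (\<lambda>_. gauss_vec d 1) \<partial>gauss_vec d 1)"
    by (rule product_nn_integral_insert_rev[of ?I a "indicator B", unfolded I[symmetric],
          OF _ _ borel_measurable_indicator[OF B_sets]]) simp_all
  also have "\<dots> \<le> (\<integral>\<^sup>+y. ennreal ((1 - p) ^ (n - 1)) * indicator ?G y \<partial>gauss_vec d 1)"
  proof (rule nn_integral_mono)
    fix y assume y: "y \<in> space (gauss_vec d 1)"
    show "(\<integral>\<^sup>+X. indicator B (X(a := y)) \<partial>PiM ?I (\<lambda>_. gauss_vec d 1)) \<le> ennreal ((1 - p) ^ (n - 1)) * indicator ?G y"
    proof (cases "y \<in> ?G")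
      case False
      then have "indicator B (X(a := y)) = (0::ennreal)" for X
        by (auto simp: B_def G_def)
      then show ?thesis by simp
    next
      case True
      let ?C = "space (gauss_vec d 1) - cube d y s"
      have "(\<integral>\<^sup>+X. indicator B (X(a := y)) \<partial>PiM ?I (\<lambda>_. gauss_vec d 1))
          \<le> (\<integral>\<^sup>+X. (\<Prod>b\<in>?I. indicator ?C (X b)) \<partial>PiM ?I (\<lambda>_. gauss_vec d 1))"
      proof (rule nn_integral_mono)
        fix X assume X: "X \<in> space (PiM ?I (\<lambda>_. gauss_vec d 1))"
        show "indicator B (X(a := y)) \<le> (\<Prod>b\<in>?I. indicator ?C (X b) :: ennreal)"
        proof (cases "X(a := y) \<in> B")
          case XB: True
          have "X b \<in> ?C" if b: "b \<in> ?I" for b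
          proof
            show "X b \<in> space (gauss_vec d 1)"
              using X b unfolding space_PiM by (rule PiE_mem)
            show "X b \<notin> cube d y s"
            proof
              assume "X b \<in> cube d y s"
              then have "\<forall>k\<in>{1..d}. \<bar>(X(a := y)) b k - (X(a := y)) a k\<bar> \<le> s"
                using b by (simp add: cube_def)
              moreover have "X(a := y) \<in> space (points_space n d)"
                using XB unfolding B_def G_def sets_eq_imp_space_eq[OF sets_gauss_pts] by blast
              ultimately have "X(a := y) \<in> neighbour_set n d s a"
                unfolding neighbour_set_def using b by blast
              then show False using XB unfolding B_def by blast
            qed
          qed
          then have "(\<Prod>b\<in>?I. indicator ?C (X b) :: ennreal) = 1" by (intro prod.neutral) auto
          then show ?thesis by (simp add: indicator_def)
        qed simp
      qed
      also have "\<dots> = (\<Prod>b\<in>?I. emeasure (gauss_vec d 1) ?C)"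
        by (subst product_nn_integral_prod) (simp_all add: cube_sets sets.compl_sets)
      also have "\<dots> \<le> (\<Prod>b\<in>?I. ennreal (1 - p))"
      proof (rule prod_mono_ennreal)
        have "ennreal p \<le> emeasure (gauss_vec d 1) (cube d y s)"
          unfolding p_def by (rule emeasure_cube_around_ge[OF s True])
        then have "p \<le> measure (gauss_vec d 1) (cube d y s)"
          by (simp add: Vec.emeasure_eq_measure)
        then show "emeasure (gauss_vec d 1) ?C \<le> ennreal (1 - p)"
          by (simp add: Vec.emeasure_eq_measure Vec.prob_compl cube_sets ennreal_leI)
      qed
      also have "\<dots> = ennreal ((1 - p) ^ (n - 1))"
        using p a by (simp add: ennreal_power)
      finally show ?thesis using True by simp
    qed
  qed
  also have "\<dots> = ennreal ((1 - p) ^ (n - 1)) * emeasure (gauss_pts n d 1) G"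
    unfolding eG by (rule nn_integral_cmult_indicator[OF cube_sets])
  finally have B: "measure (gauss_pts n d 1) B \<le> (1 - p) ^ (n - 1) * measure (gauss_pts n d 1) G"
    using p unfolding P.emeasure_eq_measure by (simp add: ennreal_mult'[symmetric])
  have "ennreal (exp (- real d)) = ennreal (1 / 1 * exp (- (1\<^sup>2 + 1) / 2)) ^ d"
    by (simp add: ennreal_power exp_of_nat_mult[symmetric])
  also have "\<dots> \<le> emeasure (gauss_vec d 1) ?G"
    by (rule emeasure_gauss_vec_cube_ge) auto
  finally have g: "exp (- real d) \<le> measure (gauss_pts n d 1) G"
    unfolding eG[symmetric] P.emeasure_eq_measure by simp
  \<comment> \<open>The bound on \<open>B\<close> is relative to the measure of \<open>G\<close>, so
    the difference is a multiple of that measure, and only then is the lower bound \<open>g\<close>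
    for it inserted.\<close>
  have "exp (- real d) * (1 - (1 - p) ^ (n - 1)) \<le> measure (gauss_pts n d 1) G * (1 - (1 - p) ^ (n - 1))"
    using p by (intro mult_right_mono g) (auto intro!: power_le_one)
  also have "\<dots> \<le> measure (gauss_pts n d 1) G - measure (gauss_pts n d 1) B"
    using B by (simp add: algebra_simps)
  also have "\<dots> = measure (gauss_pts n d 1) (G - B)"
    by (rule P.finite_measure_Diff[symmetric, OF G_sets B_sets]) (auto simp: B_def)
  also have "\<dots> \<le> measure (gauss_pts n d 1) (neighbour_set n d s a)"
    by (rule P.finite_measure_mono[OF _ ns]) (auto simp: B_def)
  finally show ?thesis
    unfolding p_def P.emeasure_eq_measure by (rule ennreal_leI)
qed

text \<open>Counts errors by true label instead of by index. Closeness of \<open>X a\<close> and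
  \<open>X b\<close> is a property of labels, so the two-point argument bounds the terms of this
  sum.\<close>

lemma ennreal_d_H_inv:
  assumes "p \<in> perms n"
  shows "ennreal (d_H n q p) = (\<Sum>a=1..n. of_bool (q (inv p a) \<noteq> a))"
proof -
  have p: "p permutes {1..n}" using assms by (simp only: perms_def mem_Collect_eq)
  have "(\<Sum>a=1..n. of_bool (q (inv p a) \<noteq> a) :: ennreal) = (\<Sum>j=1..n. of_bool (q (inv p (p j)) \<noteq> p j))"
    by (rule sum.permute[OF p, unfolded comp_def])
  then show ?thesis
    unfolding ennreal_d_H permutes_inverses(2)[OF p] by (rule sym)
qed

lemma risk_nonneg: "0 \<le> risk n d s est"
  unfolding risk_def by (rule integral_nonneg_AE) (simp add: split_beta d_H_nonneg)

text \<open>Sums over the labels \<open>a\<close> the probability that \<open>X a\<close> has a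
  close neighbour times the conditional error bound from \<open>neighbour_error_ge\<close>.\<close>

lemma risk_ge:
  assumes s: "0 < s" and est: "est \<in> estimators n d"
  shows "real n * (exp (- (6 * real d)) / 2 * (exp (- real d) * (1 - (1 - (min s 1 * exp (- 3)) ^ d) ^ (n - 1))))
    \<le> risk n d s est"
proof -
  define K where "K = exp (- (6 * real d)) / 2"
  define L where "L = exp (- real d) * (1 - (1 - (min s 1 * exp (- 3)) ^ d) ^ (n - 1))"
  define e where "e X p a Z = (of_bool (est (X, Y_obs n d X Z p) (inv p a) \<noteq> a) :: ennreal)" for X p a Z
  let ?c = "ennreal (1 / real (card (perms n)))"
  have ns: "neighbour_set n d s a \<in> sets (gauss_pts n d 1)" if "a \<in> {1..n}" for a
    unfolding sets_gauss_pts by (rule neighbour_set_sets[OF that])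
  have K: "0 \<le> K" by (simp add: K_def)
  have "ennreal (real n * (K * L)) = (\<Sum>a=1..n. ennreal K * ennreal L)"
    by (simp add: ennreal_mult' K ennreal_of_nat_eq_real_of_nat)
  also have "\<dots> \<le> (\<Sum>a=1..n. ennreal K * emeasure (gauss_pts n d 1) (neighbour_set n d s a))"
    unfolding L_def by (intro sum_mono mult_left_mono emeasure_neighbour_set_ge s) auto
  also have "\<dots> = (\<Sum>a=1..n. \<integral>\<^sup>+X. ennreal K * indicator (neighbour_set n d s a) X \<partial>gauss_pts n d 1)"
    by (intro sum.cong refl nn_integral_cmult_indicator[symmetric] ns)
  also have "\<dots> = (\<integral>\<^sup>+X. (\<Sum>a=1..n. ennreal K * indicator (neighbour_set n d s a) X) \<partial>gauss_pts n d 1)"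
    by (intro nn_integral_sum[symmetric] borel_measurable_times_ennreal borel_measurable_indicator ns) auto
  also have "\<dots> \<le> (\<integral>\<^sup>+X. \<integral>\<^sup>+Z. (\<Sum>p\<in>perms n. ?c * ennreal (d_H n (est (X, Y_obs n d X Z p)) p))
      \<partial>gauss_pts n d s \<partial>gauss_pts n d 1)"
  proof (rule nn_integral_mono)
    fix X assume "X \<in> space (gauss_pts n d 1)"
    then have X: "X \<in> space (points_space n d)"
      unfolding sets_eq_imp_space_eq[OF sets_gauss_pts] .
    have meas: "e X p a \<in> borel_measurable (gauss_pts n d s)" if "p \<in> perms n" for p a
      unfolding e_def
      by (rule measurable_compose[OF measurable_estimate[OF est that measurable_const[OF X] measurable_ident_sets[OF sets_gauss_pts]]]) simp
    have "(\<Sum>a=1..n. ennreal K * indicator (neighbour_set n d s a) X)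
        \<le> (\<Sum>a=1..n. \<Sum>p\<in>perms n. ?c * (\<integral>\<^sup>+Z. e X p a Z \<partial>gauss_pts n d s))"
    proof (rule sum_mono)
      fix a assume a: "a \<in> {1..n}"
      show "ennreal K * indicator (neighbour_set n d s a) X
          \<le> (\<Sum>p\<in>perms n. ?c * (\<integral>\<^sup>+Z. e X p a Z \<partial>gauss_pts n d s))"
      proof (cases "X \<in> neighbour_set n d s a")
        case True
        then obtain b where b: "b \<in> {1..n}" "b \<noteq> a" "\<And>k. k \<in> {1..d} \<Longrightarrow> \<bar>X b k - X a k\<bar> \<le> s"
          unfolding neighbour_set_def by blast
        show ?thesis
          using neighbour_error_ge[OF s est X a b] True unfolding e_def K_def by simp
      qed simp
    qed
    also have "\<dots> = (\<Sum>a=1..n. \<Sum>p\<in>perms n. \<integral>\<^sup>+Z. ?c * e X p a Z \<partial>gauss_pts n d s)"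
      by (intro sum.cong refl nn_integral_cmult[symmetric] meas)
    also have "\<dots> = (\<Sum>a=1..n. \<integral>\<^sup>+Z. (\<Sum>p\<in>perms n. ?c * e X p a Z) \<partial>gauss_pts n d s)"
      by (intro sum.cong refl nn_integral_sum[symmetric] borel_measurable_times_ennreal meas) auto
    also have "\<dots> = (\<integral>\<^sup>+Z. (\<Sum>a=1..n. \<Sum>p\<in>perms n. ?c * e X p a Z) \<partial>gauss_pts n d s)"
      by (intro nn_integral_sum[symmetric] borel_measurable_sum borel_measurable_times_ennreal meas) auto
    \<comment> \<open>For each permutation, the errors summed over the labels give back the Hamming
      distance.\<close>
    also have "\<dots> = (\<integral>\<^sup>+Z. (\<Sum>p\<in>perms n. ?c * ennreal (d_H n (est (X, Y_obs n d X Z p)) p)) \<partial>gauss_pts n d s)"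
      unfolding e_def
      by (subst sum.swap) (intro nn_integral_cong sum.cong refl, simp only: ennreal_d_H_inv sum_distrib_left)
    finally show "(\<Sum>a=1..n. ennreal K * indicator (neighbour_set n d s a) X)
      \<le> (\<integral>\<^sup>+Z. (\<Sum>p\<in>perms n. ?c * ennreal (d_H n (est (X, Y_obs n d X Z p)) p)) \<partial>gauss_pts n d s)" .
  qed
  also have "\<dots> = ennreal (risk n d s est)"
    by (rule ennreal_risk[OF s est, symmetric])
  finally show ?thesis
    unfolding K_def L_def by (simp only: ennreal_le_iff[OF risk_nonneg])
qed

text \<open>With \<open>x = m * p\<close> one has
  \<open>(1 - p) ^ m \<le> exp (- x) \<le> 1 / (1 + x)\<close>, and \<open>x / (1 + x)\<close> is at
  least half of \<open>min x 1\<close>.\<close>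

lemma one_minus_power_ge:
  fixes p :: real
  assumes "0 \<le> p" "p \<le> 1"
  shows "min (real m * p) 1 / 2 \<le> 1 - (1 - p) ^ m"
proof -
  define x where "x = real m * p"
  have x: "0 \<le> x" using assms by (simp add: x_def)
  have "(1 - p) ^ m \<le> exp (- p) ^ m"
    using assms exp_ge_add_one_self[of "- p"] by (intro power_mono) auto
  also have "\<dots> = inverse (exp x)"
    by (simp add: x_def exp_of_nat_mult exp_minus power_inverse)
  also have "\<dots> \<le> inverse (1 + x)"
    using x exp_ge_add_one_self[of x] by (intro le_imp_inverse_le) auto
  also have "\<dots> \<le> 1 - min x 1 / 2"
  proof (cases "x \<le> 1")
    case True
    have "x * x \<le> 1 * x" using x True by (intro mult_right_mono)
    then show ?thesis using x True by (simp add: field_simps)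
  next
    case False
    then show ?thesis by (simp add: field_simps)
  qed
  finally show ?thesis by (simp add: x_def)
qed

lemma risk_ge_min:
  assumes s: "0 < s" and est: "est \<in> estimators n d" and n: "2 \<le> n"
  shows "exp (- (3 + 10 * real d)) * min (real n ^ 2 * s ^ d) (real n) \<le> risk n d s est"
proof -
  define p where "p = (min s 1 * exp (- 3)) ^ d"
  have "0 \<le> min s 1 * exp (- 3)" using s by simp
  moreover have "min s 1 * exp (- 3) \<le> 1 * 1" by (rule mult_mono) (use s in auto)
  ultimately have p: "0 \<le> p" "p \<le> 1"
    unfolding p_def by (simp_all add: power_le_one)
  have pe: "p = min s 1 ^ d * exp (- (3 * real d))"
    by (simp add: p_def power_mult_distrib exp_of_nat_mult[symmetric])
  \<comment> \<open>For \<open>s\<close> above 1 the right-hand minimum is already 1, so capping the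
    scale loses nothing.\<close>
  have "min (real n * s ^ d) 1 \<le> min (real n * min s 1 ^ d) 1"
    using n by (cases "s \<le> 1") auto
  then have "exp (- (3 * real d)) * min (real n * s ^ d) 1 \<le> exp (- (3 * real d)) * min (real n * min s 1 ^ d) 1"
    by (rule mult_left_mono) simp
  also have "\<dots> \<le> min (real n * p) 1"
  proof (rule min.boundedI)
    show "exp (- (3 * real d)) * min (real n * min s 1 ^ d) 1 \<le> real n * p"
      using mult_left_mono[of "min (real n * min s 1 ^ d) 1" "real n * min s 1 ^ d" "exp (- (3 * real d))"]
      by (simp add: pe mult_ac)
    have "exp (- (3 * real d)) * min (real n * min s 1 ^ d) 1 \<le> 1 * 1"
      using s by (intro mult_mono) auto
    then show "exp (- (3 * real d)) * min (real n * min s 1 ^ d) 1 \<le> 1" by simp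
  qed
  also have "\<dots> \<le> 2 * min (real (n - 1) * p) 1"
  proof -
    \<comment> \<open>From \<open>2 \<le> n\<close>: passing from \<open>n - 1\<close> to
      \<open>n\<close> costs a factor 2.\<close>
    have "real n * p \<le> 2 * (real (n - 1) * p)"
      using n p mult_right_mono[of "real n" "2 * real (n - 1)" p] by (simp add: algebra_simps)
    then show ?thesis by auto
  qed
  also have "\<dots> \<le> 4 * (1 - (1 - p) ^ (n - 1))"
    using one_minus_power_ge[OF p, of "n - 1"] by simp
  finally have 1: "exp (- (3 * real d)) * min (real n * s ^ d) 1 / 4 \<le> 1 - (1 - p) ^ (n - 1)"
    by simp
  \<comment> \<open>The 8 is the 4 just obtained times the 2 in the error bound. The 10 d collects 6
    d from the two-point argument, d from the central cube and 3 d from \<open>p\<close>.\<close>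
  have "exp (- 3) \<le> (1 / 8 :: real)"
    using power_mono[of 2 "exp 1 :: real" 3] exp_ge_add_one_self[of 1]
    by (simp add: exp_of_nat_mult[symmetric] exp_minus field_simps)
  then have "exp (- (3 + 10 * real d)) * (real n * min (real n * s ^ d) 1)
      \<le> 1 / 8 * exp (- (10 * real d)) * (real n * min (real n * s ^ d) 1)"
    using s by (intro mult_right_mono) (auto simp: exp_diff exp_minus field_simps)
  also have "\<dots> = real n * (exp (- (6 * real d)) / 2 * (exp (- real d) * (exp (- (3 * real d)) * min (real n * s ^ d) 1 / 4)))"
    by (simp add: exp_add[symmetric])
  also have "\<dots> \<le> real n * (exp (- (6 * real d)) / 2 * (exp (- real d) * (1 - (1 - p) ^ (n - 1))))"
    by (intro mult_left_mono 1) auto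
  also have "\<dots> \<le> risk n d s est"
    unfolding p_def by (rule risk_ge[OF s est])
  finally show ?thesis
    using n by (simp add: min_mult_distrib_left power2_eq_square mult.assoc)
qed

section \<open>The upper bound\<close>

definition sqdist :: "nat \<Rightarrow> (nat \<Rightarrow> real) \<Rightarrow> (nat \<Rightarrow> real) \<Rightarrow> real"
  where "sqdist d x y = (\<Sum>k=1..d. (x k - y k)\<^sup>2)"

text \<open>The inequality is not strict, so a tie counts as a failure. Hence at most one label per
  index can succeed, which is what compares two permutations in
  \<open>d_H_le_nn_cost\<close>.\<close>

definition not_nearest ::
    "nat \<Rightarrow> nat \<Rightarrow> (nat \<Rightarrow> nat) \<Rightarrow> nat \<Rightarrow> (nat \<Rightarrow> nat \<Rightarrow> real) \<times> (nat \<Rightarrow> nat \<Rightarrow> real) \<Rightarrow> bool"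
  where "not_nearest n d p i = (\<lambda>(X, Y).
    \<exists>j\<in>{1..n} - {p i}. sqdist d (Y i) (X j) \<le> sqdist d (Y i) (X (p i)))"

definition nn_cost ::
    "nat \<Rightarrow> nat \<Rightarrow> (nat \<Rightarrow> nat) \<Rightarrow> (nat \<Rightarrow> nat \<Rightarrow> real) \<times> (nat \<Rightarrow> nat \<Rightarrow> real) \<Rightarrow> real"
  where "nn_cost n d p w = (\<Sum>i=1..n. if not_nearest n d p i w then 1 else 0)"

text \<open>The estimate depends on the data only through this set, which takes finitely many
  values; it is introduced for the proof of measurability.\<close>

definition nn_minimizers ::
    "nat \<Rightarrow> nat \<Rightarrow> (nat \<Rightarrow> nat \<Rightarrow> real) \<times> (nat \<Rightarrow> nat \<Rightarrow> real) \<Rightarrow> (nat \<Rightarrow> nat) set"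
  where "nn_minimizers n d w = {p \<in> perms n. \<forall>q\<in>perms n. nn_cost n d p w \<le> nn_cost n d q w}"

definition nn_est ::
    "nat \<Rightarrow> nat \<Rightarrow> (nat \<Rightarrow> nat \<Rightarrow> real) \<times> (nat \<Rightarrow> nat \<Rightarrow> real) \<Rightarrow> (nat \<Rightarrow> nat)"
  where "nn_est n d w = (SOME p. p \<in> nn_minimizers n d w)"

lemma nn_minimizers_nonempty: "nn_minimizers n d w \<noteq> {}"
proof -
  obtain p where "p \<in> perms n" "\<And>q. q \<in> perms n \<Longrightarrow> nn_cost n d p w \<le> nn_cost n d q w"
    using arg_min_if_finite(1)[OF finite_perms perms_nonempty, where f="\<lambda>p. nn_cost n d p w"]
      arg_min_least[OF finite_perms perms_nonempty, where f="\<lambda>p. nn_cost n d p w"] by metis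
  then show ?thesis unfolding nn_minimizers_def by blast
qed

lemma nn_est_minimizer: "nn_est n d w \<in> nn_minimizers n d w"
  unfolding nn_est_def using nn_minimizers_nonempty by (simp add: some_in_eq)

lemma pred_real_le:
  fixes f g :: "'a \<Rightarrow> real"
  assumes [measurable]: "f \<in> borel_measurable M" "g \<in> borel_measurable M"
  shows "Measurable.pred M (\<lambda>w. f w \<le> g w)"
  by measurable

lemma pred_not_nearest:
  assumes p: "p \<in> perms n" and i: "i \<in> {1..n}"
  shows "Measurable.pred (points_space n d \<Otimes>\<^sub>M points_space n d) (not_nearest n d p i)"
proof -
  have m: "(\<lambda>w. sqdist d (snd w i) (fst w j)) \<in> borel_measurable (points_space n d \<Otimes>\<^sub>M points_space n d)"
    if "j \<in> {1..n}" for j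
    unfolding sqdist_def
    by (intro borel_measurable_sum borel_measurable_power borel_measurable_diff
          measurable_compose[OF measurable_fst measurable_points_coord]
          measurable_compose[OF measurable_snd measurable_points_coord] i that)
  have "Measurable.pred (points_space n d \<Otimes>\<^sub>M points_space n d)
      (\<lambda>w. \<exists>j\<in>{1..n} - {p i}. sqdist d (snd w i) (fst w j) \<le> sqdist d (snd w i) (fst w (p i)))"
  proof (rule pred_intros_finite(4))
    fix j assume "j \<in> {1..n} - {p i}"
    then show "Measurable.pred (points_space n d \<Otimes>\<^sub>M points_space n d)
        (\<lambda>w. sqdist d (snd w i) (fst w j) \<le> sqdist d (snd w i) (fst w (p i)))"
      by (intro pred_real_le m perms_mem[OF p i]) blast
  qed simp
  then show ?thesis
    unfolding not_nearest_def split_beta' .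
qed

lemma borel_measurable_nn_cost:
  assumes p: "p \<in> perms n"
  shows "nn_cost n d p \<in> borel_measurable (points_space n d \<Otimes>\<^sub>M points_space n d)"
  unfolding nn_cost_def[abs_def]
  by (intro borel_measurable_sum measurable_If borel_measurable_const predE pred_not_nearest[OF p])

text \<open>Each value of \<open>nn_minimizers\<close> is attained on a set described by finitely
  many inequalities between measurable costs. The subsequent choice is a map on a discrete space and
  thus measurable; excluding the empty set ensures that it lands in \<open>perms n\<close>.\<close>

lemma nn_est_estimator: "nn_est n d \<in> estimators n d"
proof -
  let ?M = "points_space n d \<Otimes>\<^sub>M points_space n d"
  have "nn_minimizers n d \<in> ?M \<rightarrow>\<^sub>M count_space (Pow (perms n) - {{}})"
  proof (subst measurable_count_space_eq2)
    show "finite (Pow (perms n) - {{}})" using finite_perms by simp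
    have "nn_minimizers n d -` {T} \<inter> space ?M \<in> sets ?M" if T: "T \<in> Pow (perms n)" for T
    proof -
      have "Measurable.pred ?M (\<lambda>w. \<forall>p\<in>perms n. (p \<in> T) = (\<forall>q\<in>perms n. nn_cost n d p w \<le> nn_cost n d q w))"
        by (intro pred_intros_finite pred_intros_logic pred_real_le borel_measurable_nn_cost finite_perms)
           (rule measurable_const, simp)
      moreover have "nn_minimizers n d -` {T} \<inter> space ?M
          = {w \<in> space ?M. \<forall>p\<in>perms n. (p \<in> T) = (\<forall>q\<in>perms n. nn_cost n d p w \<le> nn_cost n d q w)}"
        using T unfolding nn_minimizers_def by blast
      ultimately show ?thesis by (simp only: predE)
    qed
    moreover have "nn_minimizers n d \<in> space ?M \<rightarrow> Pow (perms n) - {{}}"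
      using nn_minimizers_nonempty unfolding nn_minimizers_def by blast
    ultimately show "nn_minimizers n d \<in> space ?M \<rightarrow> Pow (perms n) - {{}} \<and>
        (\<forall>T\<in>Pow (perms n) - {{}}. nn_minimizers n d -` {T} \<inter> space ?M \<in> sets ?M)"
      by blast
  qed
  moreover have "(\<lambda>T. SOME p. p \<in> T) \<in> count_space (Pow (perms n) - {{}}) \<rightarrow>\<^sub>M count_space (perms n)"
    unfolding measurable_count_space_eq1
  proof (rule funcsetI)
    fix T assume "T \<in> Pow (perms n) - {{}}"
    then have "T \<noteq> {}" "T \<subseteq> perms n" by blast+
    then show "(SOME p. p \<in> T) \<in> space (count_space (perms n))"
      unfolding space_count_space by (metis some_in_eq subsetD)
  qed
  ultimately show ?thesis
    unfolding estimators_def nn_est_def[abs_def] by (rule measurable_compose)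
qed

text \<open>If \<open>p i \<noteq> q i\<close>, then one of \<open>p i\<close> and \<open>q i\<close> is not the unique nearest neighbour of \<open>Y i\<close>.\<close>

lemma d_H_le_nn_cost:
  assumes "p \<in> perms n" "q \<in> perms n"
  shows "d_H n p q \<le> nn_cost n d p w + nn_cost n d q w"
proof -
  obtain X Y where w: "w = (X, Y)" by fastforce
  show ?thesis
    unfolding d_H_def nn_cost_def sum.distrib[symmetric]
  proof (rule sum_mono)
    fix i assume i: "i \<in> {1..n}"
    have pq: "p i \<in> {1..n}" "q i \<in> {1..n}" using assms i by (simp_all only: perms_mem)
    have "not_nearest n d p i w \<or> not_nearest n d q i w" if "p i \<noteq> q i"
    proof (cases "sqdist d (Y i) (X (q i)) \<le> sqdist d (Y i) (X (p i))")
      case True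
      have "not_nearest n d p i w"
        unfolding not_nearest_def w prod.case by (rule bexI[where x="q i"]) (use True pq that in simp_all)
      then show ?thesis ..
    next
      case False
      then have le: "sqdist d (Y i) (X (p i)) \<le> sqdist d (Y i) (X (q i))" by simp
      have "not_nearest n d q i w"
        unfolding not_nearest_def w prod.case by (rule bexI[where x="p i"]) (use le pq that in simp_all)
      then show ?thesis ..
    qed
    then show "of_bool (p i \<noteq> q i) \<le> (if not_nearest n d p i w then 1 else 0) + (if not_nearest n d q i w then 1 else (0::real))"
      by (cases "p i = q i") auto
  qed
qed

text \<open>By minimality the cost of the estimate is at most that of the truth, so both terms of
  \<open>d_H_le_nn_cost\<close> are bounded by the latter.\<close>

lemma d_H_nn_est_le:
  assumes "p \<in> perms n"
  shows "d_H n (nn_est n d w) p \<le> 2 * nn_cost n d p w"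
proof -
  have e: "nn_est n d w \<in> perms n" "nn_cost n d (nn_est n d w) w \<le> nn_cost n d p w"
    using nn_est_minimizer[of n d w] assms unfolding nn_minimizers_def by blast+
  show ?thesis using d_H_le_nn_cost[OF e(1) assms, of d w] e(2) by linarith
qed

text \<open>With \<open>a\<close> the true label of \<open>i\<close>, this is the exponential of the
  squared norm of \<open>Z i\<close> minus the squared distance from \<open>Y i\<close> to
  \<open>X j\<close>, divided by \<open>4 * s\<^sup>2\<close>. It dominates the indicator that
  \<open>X j\<close> is at least as near as \<open>X a\<close>; the two products separate the factor
  containing \<open>X j\<close>.\<close>

definition chernoff_kernel ::
    "nat \<Rightarrow> real \<Rightarrow> nat \<Rightarrow> nat \<Rightarrow> nat \<Rightarrow> (nat \<Rightarrow> nat \<Rightarrow> real) \<times> (nat \<Rightarrow> nat \<Rightarrow> real) \<Rightarrow> ennreal"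
  where "chernoff_kernel d s a i j = (\<lambda>(X, Z).
    (\<Prod>k=1..d. ennreal (exp (- (X a k + Z i k - X j k)\<^sup>2 / (4 * s\<^sup>2)))) *
    (\<Prod>k=1..d. ennreal (exp ((Z i k)\<^sup>2 / (4 * s\<^sup>2)))))"

lemma chernoff_kernel_ge_1:
  assumes s: "0 < s" and le: "(\<Sum>k=1..d. (X a k + Z i k - X j k)\<^sup>2) \<le> (\<Sum>k=1..d. (Z i k)\<^sup>2)"
  shows "1 \<le> chernoff_kernel d s a i j (X, Z)"
proof -
  have "chernoff_kernel d s a i j (X, Z)
      = ennreal (exp (((\<Sum>k=1..d. (Z i k)\<^sup>2) - (\<Sum>k=1..d. (X a k + Z i k - X j k)\<^sup>2)) / (4 * s\<^sup>2)))"
    unfolding chernoff_kernel_def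
    by (simp add: prod_ennreal exp_sum[symmetric] ennreal_mult'[symmetric] exp_add[symmetric]
        sum_negf sum_divide_distrib[symmetric] diff_divide_distrib)
  also have "\<dots> \<ge> ennreal 1"
    using s le by (intro ennreal_leI) simp
  finally show ?thesis by simp
qed

text \<open>Union bound over the index \<open>i\<close> and the competing label \<open>j\<close>,
  using that the true residual of \<open>Y i\<close> is exactly \<open>Z i\<close>.\<close>

lemma nn_cost_le_chernoff:
  assumes s: "0 < s" and p: "p \<in> perms n"
  shows "ennreal (nn_cost n d p (X, Y_obs n d X Z p))
    \<le> (\<Sum>i=1..n. \<Sum>j\<in>{1..n} - {p i}. chernoff_kernel d s (p i) i j (X, Z))"
proof -
  have "ennreal (nn_cost n d p (X, Y_obs n d X Z p))
      = (\<Sum>i=1..n. ennreal (if not_nearest n d p i (X, Y_obs n d X Z p) then 1 else 0))"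
    unfolding nn_cost_def by (rule sum_ennreal[symmetric]) simp
  also have "\<dots> \<le> (\<Sum>i=1..n. \<Sum>j\<in>{1..n} - {p i}. chernoff_kernel d s (p i) i j (X, Z))"
  proof (rule sum_mono)
    fix i assume i: "i \<in> {1..n}"
    show "ennreal (if not_nearest n d p i (X, Y_obs n d X Z p) then 1 else 0)
        \<le> (\<Sum>j\<in>{1..n} - {p i}. chernoff_kernel d s (p i) i j (X, Z))"
    proof (cases "not_nearest n d p i (X, Y_obs n d X Z p)")
      case True
      then obtain j where j: "j \<in> {1..n} - {p i}"
        and le: "sqdist d (Y_obs n d X Z p i) (X j) \<le> sqdist d (Y_obs n d X Z p i) (X (p i))"
        unfolding not_nearest_def by blast
      have Y: "Y_obs n d X Z p i k = X (p i) k + Z i k" if "k \<in> {1..d}" for k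
        using i that unfolding Y_obs_def by (simp only: restrict_apply')
      have eqs: "(\<Sum>k=1..d. (Y_obs n d X Z p i k - X j k)\<^sup>2) = (\<Sum>k=1..d. (X (p i) k + Z i k - X j k)\<^sup>2)"
          "(\<Sum>k=1..d. (Y_obs n d X Z p i k - X (p i) k)\<^sup>2) = (\<Sum>k=1..d. (Z i k)\<^sup>2)"
        by (intro sum.cong refl; simp only: Y; simp)+
      have "1 \<le> chernoff_kernel d s (p i) i j (X, Z)"
        by (rule chernoff_kernel_ge_1[OF s]) (use le in \<open>simp only: sqdist_def eqs\<close>)
      also have "\<dots> \<le> (\<Sum>j\<in>{1..n} - {p i}. chernoff_kernel d s (p i) i j (X, Z))"
        by (rule member_le_sum[OF j]) simp_all
      finally show ?thesis using True by simp
    qed simp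
  qed
  finally show ?thesis .
qed

lemma borel_measurable_chernoff_kernel:
  assumes "a \<in> {1..n}" "i \<in> {1..n}" "j \<in> {1..n}"
    and f: "f \<in> M \<rightarrow>\<^sub>M points_space n d" and g: "g \<in> M \<rightarrow>\<^sub>M points_space n d"
  shows "(\<lambda>w. chernoff_kernel d s a i j (f w, g w)) \<in> borel_measurable M"
proof -
  have [measurable]: "(\<lambda>w. f w l k) \<in> borel_measurable M" "(\<lambda>w. g w l k) \<in> borel_measurable M"
    if "l \<in> {1..n}" "k \<in> {1..d}" for l k
    using measurable_compose[OF f measurable_points_coord[OF that]]
      measurable_compose[OF g measurable_points_coord[OF that]] by simp_all
  show ?thesis
    unfolding chernoff_kernel_def prod.case
    using assms(1-3)
    by (intro borel_measurable_times_ennreal borel_measurable_prod_ennreal measurable_compose[OF _ measurable_ennreal]) measurable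
qed

text \<open>Since \<open>j\<close> differs from \<open>a\<close>, the point \<open>X j\<close> is
  independent of the centre \<open>X a + Z i\<close>. Integrating over \<open>X j\<close> first
  gives \<open>(sqrt 2 * s) ^ d\<close> whatever the centre, and the exponential moment of
  \<open>Z i\<close> contributes \<open>sqrt 2 ^ d\<close>.\<close>

lemma nn_integral_chernoff_kernel_le:
  assumes s: "0 < s" and a: "a \<in> {1..n}" and i: "i \<in> {1..n}" and j: "j \<in> {1..n}" "j \<noteq> a"
  shows "(\<integral>\<^sup>+w. chernoff_kernel d s a i j w \<partial>(gauss_pts n d 1 \<Otimes>\<^sub>M gauss_pts n d s)) \<le> ennreal ((2 * s) ^ d)"
proof -
  interpret X: product_prob_space "\<lambda>_::nat. gauss_vec d 1" "{1..n}"
    by (rule product_prob_space_gauss_vec) simp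
  interpret X': prob_space "PiM ({1..n} - {j}) (\<lambda>_. gauss_vec d 1)"
    by (intro prob_space_PiM prob_space_gauss_vec) simp
  interpret Z: product_prob_space "\<lambda>_::nat. gauss_vec d s" "{1..n}"
    by (rule product_prob_space_gauss_vec) fact
  interpret XZ: pair_sigma_finite "gauss_pts n d 1" "gauss_pts n d s" ..
  let ?B = "\<lambda>z. \<Prod>k=1..d. ennreal (exp ((z k)\<^sup>2 / (4 * s\<^sup>2)))"
  have B: "(\<lambda>z. ennreal (sqrt 2 * s) ^ d * ?B z) \<in> borel_measurable (gauss_vec d s)"
    by measurable
  have ins: "insert j ({1..n} - {j}) = {1..n}" using j(1) by auto
  have meas_snd: "(\<lambda>X. chernoff_kernel d s a i j (X, Z)) \<in> borel_measurable (gauss_pts n d 1)"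
    if "Z \<in> space (gauss_pts n d s)" for Z
    using that unfolding sets_eq_imp_space_eq[OF sets_gauss_pts]
    by (intro borel_measurable_chernoff_kernel[OF a i j(1)] measurable_ident_sets[OF sets_gauss_pts] measurable_const)
  have meas: "chernoff_kernel d s a i j \<in> borel_measurable (gauss_pts n d 1 \<Otimes>\<^sub>M gauss_pts n d s)"
    using borel_measurable_chernoff_kernel[OF a i j(1),
        OF measurable_compose[OF measurable_fst measurable_ident_sets[OF sets_gauss_pts]]
          measurable_compose[OF measurable_snd measurable_ident_sets[OF sets_gauss_pts]], of d s]
    by simp
  have "(\<integral>\<^sup>+w. chernoff_kernel d s a i j w \<partial>(gauss_pts n d 1 \<Otimes>\<^sub>M gauss_pts n d s))
      = (\<integral>\<^sup>+Z. \<integral>\<^sup>+X. chernoff_kernel d s a i j (X, Z) \<partial>gauss_pts n d 1 \<partial>gauss_pts n d s)"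
    by (rule XZ.nn_integral_snd[OF meas, symmetric])
  also have "\<dots> \<le> (\<integral>\<^sup>+Z. ennreal (sqrt 2 * s) ^ d * ?B (Z i) \<partial>gauss_pts n d s)"
  proof (rule nn_integral_mono)
    fix Z assume Z: "Z \<in> space (gauss_pts n d s)"
    have "(\<integral>\<^sup>+X. chernoff_kernel d s a i j (X, Z) \<partial>gauss_pts n d 1)
        = (\<integral>\<^sup>+x. \<integral>\<^sup>+y. chernoff_kernel d s a i j (x(j := y), Z) \<partial>gauss_vec d 1 \<partial>PiM ({1..n} - {j}) (\<lambda>_. gauss_vec d 1))"
      using X.product_nn_integral_insert[of "{1..n} - {j}" j "\<lambda>X. chernoff_kernel d s a i j (X, Z)"] meas_snd[OF Z]
      unfolding ins by blast
    also have "\<dots> \<le> (\<integral>\<^sup>+x. ennreal (sqrt 2 * s) ^ d * ?B (Z i) \<partial>PiM ({1..n} - {j}) (\<lambda>_. gauss_vec d 1))"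
    proof (rule nn_integral_mono)
      fix x
      let ?A = "\<lambda>y. \<Prod>k=1..d. ennreal (exp (- ((x a k + Z i k) - y k)\<^sup>2 / (4 * s\<^sup>2)))"
      \<comment> \<open>Here \<open>j \<noteq> a\<close> enters: updating coordinate
        \<open>j\<close> leaves \<open>x a\<close> untouched, so the second factor is constant in
        \<open>y\<close>.\<close>
      have "(\<integral>\<^sup>+y. chernoff_kernel d s a i j (x(j := y), Z) \<partial>gauss_vec d 1) = (\<integral>\<^sup>+y. ?A y * ?B (Z i) \<partial>gauss_vec d 1)"
        using j(2) unfolding chernoff_kernel_def by simp
      also have "\<dots> = (\<integral>\<^sup>+y. ?A y \<partial>gauss_vec d 1) * ?B (Z i)"
        by (rule nn_integral_multc) measurable
      also have "\<dots> \<le> ennreal (sqrt 2 * s) ^ d * ?B (Z i)"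
        by (intro mult_right_mono gauss_vec_exp_neg_dist_le s) simp
      finally show "(\<integral>\<^sup>+y. chernoff_kernel d s a i j (x(j := y), Z) \<partial>gauss_vec d 1) \<le> ennreal (sqrt 2 * s) ^ d * ?B (Z i)" .
    qed
    also have "\<dots> = ennreal (sqrt 2 * s) ^ d * ?B (Z i)"
      by (simp only: nn_integral_const X'.emeasure_space_1 mult_1_right)
    finally show "(\<integral>\<^sup>+X. chernoff_kernel d s a i j (X, Z) \<partial>gauss_pts n d 1) \<le> ennreal (sqrt 2 * s) ^ d * ?B (Z i)" .
  qed
  \<comment> \<open>Only the marginal law of \<open>Z i\<close> is left.\<close>
  also have "\<dots> = (\<integral>\<^sup>+z. ennreal (sqrt 2 * s) ^ d * ?B z \<partial>distr (gauss_pts n d s) (gauss_vec d s) (\<lambda>Z. Z i))"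
    by (rule nn_integral_distr[symmetric, OF measurable_component_singleton[OF i]]) (use B in simp)
  also have "\<dots> = (\<integral>\<^sup>+z. ennreal (sqrt 2 * s) ^ d * ?B z \<partial>gauss_vec d s)"
    unfolding Z.PiM_component[OF i] ..
  also have "\<dots> = ennreal (sqrt 2 * s) ^ d * (\<integral>\<^sup>+z. ?B z \<partial>gauss_vec d s)"
    by (rule nn_integral_cmult) measurable
  also have "\<dots> = ennreal (sqrt 2 * s) ^ d * ennreal (sqrt 2) ^ d"
    unfolding gauss_vec_exp_square[OF s] ..
  also have "\<dots> = ennreal ((sqrt 2 * s) ^ d) * ennreal (sqrt 2 ^ d)"
    using s by (subst (1 2) ennreal_power) simp_all
  also have "\<dots> = ennreal ((sqrt 2 * s) ^ d * sqrt 2 ^ d)"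
    using s by (intro ennreal_mult[symmetric]) simp_all
  also have "(sqrt 2 * s) ^ d * sqrt 2 ^ d = (sqrt 2 * sqrt 2 * s) ^ d"
    by (simp only: power_mult_distrib mult_ac)
  also have "\<dots> = (2 * s) ^ d" by simp
  finally show ?thesis by simp
qed

text \<open>The 2 comes from \<open>d_H_nn_est_le\<close>, and \<open>n\<^sup>2\<close> counts the
  pairs of an index and a competing label.\<close>

lemma risk_nn_est_le:
  assumes s: "0 < s"
  shows "risk n d s (nn_est n d) \<le> 2 * real n ^ 2 * (2 * s) ^ d"
proof -
  let ?PX = "gauss_pts n d 1" and ?PZ = "gauss_pts n d s"
  let ?c = "ennreal (1 / real (card (perms n)))"
  have N: "0 < real (card (perms n))" using finite_perms perms_nonempty by (simp add: card_gt_0_iff)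
  interpret Z: prob_space ?PZ by (rule prob_space_gauss_pts) fact
  define H where "H w = (\<Sum>p\<in>perms n. ?c * (2 * (\<Sum>i=1..n. \<Sum>j\<in>{1..n} - {p i}. chernoff_kernel d s (p i) i j w)))" for w
  have K: "chernoff_kernel d s (p i) i j \<in> borel_measurable (?PX \<Otimes>\<^sub>M ?PZ)"
    if "p \<in> perms n" "i \<in> {1..n}" "j \<in> {1..n} - {p i}" for p i j
    using borel_measurable_chernoff_kernel[OF perms_mem[OF that(1,2)] that(2), of j,
        OF _ measurable_compose[OF measurable_fst measurable_ident_sets[OF sets_gauss_pts]]
          measurable_compose[OF measurable_snd measurable_ident_sets[OF sets_gauss_pts]], of d s] that(3)
    by simp
  have S: "(\<lambda>w. \<Sum>i=1..n. \<Sum>j\<in>{1..n} - {p i}. chernoff_kernel d s (p i) i j w) \<in> borel_measurable (?PX \<Otimes>\<^sub>M ?PZ)"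
    if "p \<in> perms n" for p
    using that by (intro borel_measurable_sum K)
  have H: "H \<in> borel_measurable (?PX \<Otimes>\<^sub>M ?PZ)"
    unfolding H_def[abs_def] by (intro borel_measurable_sum borel_measurable_times_ennreal borel_measurable_const S)
  have "ennreal (risk n d s (nn_est n d)) = (\<integral>\<^sup>+X. \<integral>\<^sup>+Z. (\<Sum>p\<in>perms n.
      ?c * ennreal (d_H n (nn_est n d (X, Y_obs n d X Z p)) p)) \<partial>?PZ \<partial>?PX)"
    by (rule ennreal_risk[OF s nn_est_estimator])
  also have "\<dots> \<le> (\<integral>\<^sup>+X. \<integral>\<^sup>+Z. H (X, Z) \<partial>?PZ \<partial>?PX)"
    unfolding H_def
  proof (intro nn_integral_mono sum_mono mult_left_mono)
    fix X Z p assume p: "p \<in> perms n"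
    have "ennreal (d_H n (nn_est n d (X, Y_obs n d X Z p)) p) \<le> ennreal (2 * nn_cost n d p (X, Y_obs n d X Z p))"
      by (intro ennreal_leI d_H_nn_est_le p)
    also have "\<dots> = 2 * ennreal (nn_cost n d p (X, Y_obs n d X Z p))"
      by (simp add: ennreal_mult')
    also have "\<dots> \<le> 2 * (\<Sum>i=1..n. \<Sum>j\<in>{1..n} - {p i}. chernoff_kernel d s (p i) i j (X, Z))"
      by (intro mult_left_mono nn_cost_le_chernoff s p) simp
    finally show "ennreal (d_H n (nn_est n d (X, Y_obs n d X Z p)) p)
      \<le> 2 * (\<Sum>i=1..n. \<Sum>j\<in>{1..n} - {p i}. chernoff_kernel d s (p i) i j (X, Z))" .
  qed simp
  also have "\<dots> = (\<integral>\<^sup>+w. H w \<partial>(?PX \<Otimes>\<^sub>M ?PZ))"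
    by (rule Z.nn_integral_fst[OF H])
  also have "\<dots> = (\<Sum>p\<in>perms n. ?c * (2 * (\<Sum>i=1..n. \<Sum>j\<in>{1..n} - {p i}.
      \<integral>\<^sup>+w. chernoff_kernel d s (p i) i j w \<partial>(?PX \<Otimes>\<^sub>M ?PZ))))"
    unfolding H_def
    by (simp only: nn_integral_sum nn_integral_cmult borel_measurable_times_ennreal borel_measurable_const
          borel_measurable_sum S K cong: sum.cong)
  \<comment> \<open>The excluded label \<open>p i\<close> is put back, which makes the bound
    independent of \<open>p\<close>.\<close>
  also have "\<dots> \<le> (\<Sum>p\<in>perms n. ?c * (2 * (\<Sum>i=1..n. \<Sum>j=1..n. ennreal ((2 * s) ^ d))))"
  proof (intro sum_mono mult_left_mono)
    fix p i assume p: "p \<in> perms n" and i: "i \<in> {1..n}"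
    have "(\<Sum>j\<in>{1..n} - {p i}. \<integral>\<^sup>+w. chernoff_kernel d s (p i) i j w \<partial>(?PX \<Otimes>\<^sub>M ?PZ))
        \<le> (\<Sum>j\<in>{1..n} - {p i}. ennreal ((2 * s) ^ d))"
      by (intro sum_mono nn_integral_chernoff_kernel_le s perms_mem[OF p i] i) auto
    also have "\<dots> \<le> (\<Sum>j=1..n. ennreal ((2 * s) ^ d))"
      by (intro sum_mono2) auto
    finally show "(\<Sum>j\<in>{1..n} - {p i}. \<integral>\<^sup>+w. chernoff_kernel d s (p i) i j w \<partial>(?PX \<Otimes>\<^sub>M ?PZ))
        \<le> (\<Sum>j=1..n. ennreal ((2 * s) ^ d))" .
  qed simp_all
  also have "\<dots> = ennreal (2 * real n ^ 2 * (2 * s) ^ d)"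
    using s N by (simp add: ennreal_of_nat_eq_real_of_nat ennreal_mult'[symmetric] ennreal_mult''[symmetric]
        power2_eq_square mult.assoc flip: ennreal_numeral)
  finally show ?thesis
    using s by (subst (asm) ennreal_le_iff) auto
qed

section \<open>Asymptotics\<close>

lemma minimal_risk_ge:
  assumes s: "0 < s" and n: "2 \<le> n"
  shows "exp (- (3 + 10 * real d)) * min (real n ^ 2 * s ^ d) (real n) \<le> minimal_risk n d s"
  unfolding minimal_risk_def
proof (rule cINF_greatest)
  \<comment> \<open>The estimator of the upper bound also shows that the infimum runs over a
    nonempty set.\<close>
  show "estimators n d \<noteq> {}" using nn_est_estimator[of n d] by blast
qed (rule risk_ge_min[OF s _ n])

lemma minimal_risk_le_risk:
  assumes "est \<in> estimators n d"
  shows "minimal_risk n d s \<le> risk n d s est"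
  unfolding minimal_risk_def
  \<comment> \<open>A real infimum is a lower bound only for a set bounded below; nonnegativity of
    the risk supplies that.\<close>
  by (rule cINF_lower[OF _ assms]) (auto intro!: bdd_belowI[where m=0] risk_nonneg)

lemma risk_le:
  assumes s: "0 < s"
  shows "risk n d s est \<le> real n"
proof -
  interpret prob_space "model n d s" by (rule prob_space_model) fact
  show ?thesis
  proof (cases "integrable (model n d s) (\<lambda>(X, Z, p). d_H n (est (X, Y_obs n d X Z p)) p)")
    case True
    then show ?thesis
      unfolding risk_def by (rule integral_le_const) (simp add: split_beta d_H_le)
  next
    \<comment> \<open>A loss that is not integrable has Bochner integral 0, which satisfies the
      bound as well.\<close>
    case False
    then show ?thesis unfolding risk_def by (simp add: not_integrable_integral_eq)
  qed
qed

text \<open>The constant is enlarged to \<open>exp (3 + 10 * d)\<close>, the reciprocal of the one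
  in \<open>minimal_risk_ge\<close>, so that a single error term serves for both directions.\<close>

lemma minimal_risk_le:
  assumes s: "0 < s"
  shows "minimal_risk n d s \<le> real n"
    and "minimal_risk n d s \<le> exp (3 + 10 * real d) * (real n ^ 2 * s ^ d)"
proof -
  show "minimal_risk n d s \<le> real n"
    using minimal_risk_le_risk[OF nn_est_estimator] risk_le[OF s] by (rule order_trans)
  have "minimal_risk n d s \<le> 2 * real n ^ 2 * (2 * s) ^ d"
    using minimal_risk_le_risk[OF nn_est_estimator] risk_nn_est_le[OF s] by (rule order_trans)
  also have "\<dots> = (2 * 2 ^ d) * (real n ^ 2 * s ^ d)"
    by (simp add: power_mult_distrib)
  also have "\<dots> \<le> exp (3 + 10 * real d) * (real n ^ 2 * s ^ d)"
  proof (rule mult_right_mono)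
    have e: "2 \<le> exp (1::real)" using exp_ge_add_one_self[of 1] by simp
    have "2 * 2 ^ d \<le> exp 1 * exp (1::real) ^ d"
      by (intro mult_mono power_mono e) auto
    also have "\<dots> = exp (1 + real d)"
      by (simp add: exp_add exp_of_nat_mult[symmetric])
    finally show "2 * 2 ^ d \<le> exp (3 + 10 * real d)"
      by (rule order_trans) simp
  qed (use s in simp)
  finally show "minimal_risk n d s \<le> exp (3 + 10 * real d) * (real n ^ 2 * s ^ d)" .
qed

section \<open>From constant factors to exponents of \<open>n\<close>\<close>

lemma log_ratio_bound:
  fixes m P c l :: real
  assumes "0 < P" "0 < l" "exp (- c) * P \<le> m" "m \<le> exp c * P"
  shows "\<bar>ln (m / P) / l\<bar> \<le> c / l"
proof -
  have "0 < exp (- c) * P" using assms(1) by simp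
  then have m: "0 < m" using assms(3) by linarith
  have "ln (exp (- c)) \<le> ln (m / P)"
    using assms m by (subst ln_le_cancel_iff) (auto simp: field_simps)
  moreover have "ln (m / P) \<le> ln (exp c)"
    using assms m by (subst ln_le_cancel_iff) (auto simp: field_simps)
  ultimately have "\<bar>ln (m / P)\<bar> \<le> c" by simp
  then show ?thesis using assms(2) by (simp add: divide_right_mono)
qed

text \<open>A factor \<open>r\<close> is the same as an additional exponent
  \<open>ln r / ln x\<close>; this converts the ratio between the risk and its order of magnitude
  into the o(1) term.\<close>

lemma powr_ln_ratio:
  fixes x r :: real
  assumes "1 < x" "0 < r"
  shows "x powr (t + ln r / ln x) = x powr t * r"
proof -
  have "x powr (ln r / ln x) = r"
    using assms by (simp add: powr_def)
  then show ?thesis by (simp add: powr_add)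
qed

lemma smallo_1_of_bound:
  fixes f e :: "nat \<Rightarrow> real"
  assumes "e \<longlonglongrightarrow> 0" "\<forall>\<^sub>F n in sequentially. \<bar>f n\<bar> \<le> e n"
  shows "f \<in> o(\<lambda>_. 1)"
proof -
  have "f \<longlonglongrightarrow> 0"
    using assms by (intro Lim_null_comparison[of f e]) auto
  then show ?thesis by (intro smalloI_tendsto) auto
qed

theorem proposition2p1:
  fixes d :: "nat \<Rightarrow> nat" and \<sigma> :: "nat \<Rightarrow> real"
  assumes "(\<lambda>n. real (d n)) \<in> o(\<lambda>n. ln (real n))"
    and "\<And>n. \<sigma> n > 0"
  shows "\<exists>a b :: nat \<Rightarrow> real. a \<in> o(\<lambda>_. 1) \<and> b \<in> o(\<lambda>_. 1) \<and>
    (\<forall>\<^sub>F n in sequentially.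
       minimal_risk n (d n) (\<sigma> n)
         = min (real n powr (2 + a n) * \<sigma> n ^ d n) (real n powr (1 + b n)))"
proof -
  define m where "m n = minimal_risk n (d n) (\<sigma> n)" for n
  define P where "P n = real n ^ 2 * \<sigma> n ^ d n" for n
  define c where "c n = 3 + 10 * real (d n)" for n
  \<comment> \<open>The equality must be exact, so the whole discrepancy goes into the exponent of
    the branch attaining \<open>min (P n) (real n)\<close>, while the other exponent is 0. The other
    branch is then still at least \<open>m n\<close>, because
    \<open>m n \<le> real n\<close>.\<close>
  define a where "a n = (if P n \<le> real n then ln (m n / P n) / ln (real n) else 0)" for n
  define b where "b n = (if P n \<le> real n then 0 else ln (m n / real n) / ln (real n))" for n
  have P: "0 < P n" if "2 \<le> n" for n
    using that assms(2) by (simp add: P_def)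
  have lo: "exp (- c n) * min (P n) (real n) \<le> m n" if "2 \<le> n" for n
    unfolding m_def P_def c_def by (rule minimal_risk_ge[OF assms(2) that])
  have up: "m n \<le> real n" "m n \<le> exp (c n) * P n" for n
    unfolding m_def P_def c_def by (rule minimal_risk_le[OF assms(2)])+
  have c0: "0 \<le> c n" for n by (simp add: c_def)
  have m0: "0 < m n" if "2 \<le> n" for n
  proof -
    have "0 < exp (- c n) * min (P n) (real n)" using P[OF that] that by simp
    then show ?thesis using lo[OF that] by linarith
  qed
  \<comment> \<open>The assumption that \<open>d\<close> is o(log n) enters here: all factors lost
    are within \<open>exp (c n)\<close>, which is \<open>n\<close> to a vanishing power.\<close>
  have "(\<lambda>n. c n / ln (real n)) \<longlonglongrightarrow> 0"
  proof -
    have "(\<lambda>n. real (d n) / ln (real n)) \<longlonglongrightarrow> 0"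
      by (rule smalloD_tendsto[OF assms(1)])
    moreover have "(\<lambda>n. 3 / ln (real n)) \<longlonglongrightarrow> 0"
      by (intro tendsto_divide_0[OF tendsto_const] filterlim_at_top_imp_at_infinity
            filterlim_compose[OF ln_at_top filterlim_real_sequentially])
    ultimately have "(\<lambda>n. 3 / ln (real n) + 10 * (real (d n) / ln (real n))) \<longlonglongrightarrow> 0 + 10 * 0"
      by (intro tendsto_intros)
    then show ?thesis by (simp add: c_def add_divide_distrib)
  qed
  moreover have "\<bar>a n\<bar> \<le> c n / ln (real n)" if n: "2 \<le> n" for n
  proof (cases "P n \<le> real n")
    case True
    then show ?thesis
      using log_ratio_bound[OF P[OF n], of "ln (real n)" "c n" "m n"] lo[OF n] up(2)[of n] n
      by (simp add: a_def min_def)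
  next
    case False
    then show ?thesis using c0[of n] n by (simp add: a_def)
  qed
  moreover have "\<bar>b n\<bar> \<le> c n / ln (real n)" if n: "2 \<le> n" for n
  proof (cases "P n \<le> real n")
    case True
    then show ?thesis using c0[of n] n by (simp add: b_def)
  next
    case False
    \<comment> \<open>In this regime the upper bound is the trivial \<open>m n \<le> real n\<close>,
      weakened to the symmetric form that \<open>log_ratio_bound\<close> expects.\<close>
    have "1 * real n \<le> exp (c n) * real n"
      using c0[of n] by (intro mult_right_mono) auto
    then have "m n \<le> exp (c n) * real n" using up(1)[of n] by linarith
    then show ?thesis
      using log_ratio_bound[of "real n" "ln (real n)" "c n" "m n"] lo[OF n] False n
      by (simp add: b_def min_def)
  qed
  moreover have "m n = min (real n powr (2 + a n) * \<sigma> n ^ d n) (real n powr (1 + b n))" if n: "2 \<le> n" for n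
  proof -
    have n1: "1 < real n" using n by simp
    have P2: "real n powr 2 * \<sigma> n ^ d n = P n" using n by (simp add: P_def)
    show ?thesis
    proof (cases "P n \<le> real n")
      case True
      have "real n powr (2 + a n) * \<sigma> n ^ d n = P n * (m n / P n)"
      proof -
        have "real n powr (2 + a n) = real n powr 2 * (m n / P n)"
          using True powr_ln_ratio[OF n1, of "m n / P n" 2] m0[OF n] P[OF n] by (simp only: a_def if_True divide_pos_pos)
        then show ?thesis by (simp only: P2[symmetric] mult_ac)
      qed
      also have "\<dots> = m n" using P[OF n] by simp
      finally show ?thesis using True up(1)[of n] n by (simp add: b_def)
    next
      case False
      have "real n powr (1 + b n) = m n"
        using False powr_ln_ratio[OF n1, of "m n / real n" 1] m0[OF n] n by (simp add: b_def)
      then show ?thesis using False up(1)[of n] P2 by (simp add: a_def)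
    qed
  qed
  ultimately show ?thesis
    unfolding m_def[symmetric]
    by (intro exI[of _ a] exI[of _ b] conjI smallo_1_of_bound[where e="\<lambda>n. c n / ln (real n)"]
          eventually_sequentiallyI[of 2])
qed

end
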